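(* Let $G$ be a countable group, $(G,X,\mu)$ a $G$-system, and $S\subset G$ a generating set of $G$. If $\alpha,\beta\in\mathcal P$ are generating partitions of $(G,X,\mu)$, then for every $\epsilon>0$ there exists $\alpha'\in\mathcal P$ such that $\alpha'$ is $S$-equivalent to $\alpha$ and $d(\alpha',\beta)<\epsilon$.
   Context: A $G$-system is a measure-preserving action of $G$ on a probability space $(X,\mu)$. $\mathcal P$ is the set of measurable partitions of $X$ into at most countably many atoms with finite entropy $H(\alpha)=-\sum_{A\in\alpha}\mu(A)\log\mu(A)$, identified modulo null sets. The Rohlin distance is $d(\alpha,\beta)=H(\alpha|\beta)+H(\beta|\alpha)$, where $H(\cdot|\cdot)$ is conditional entropy; $G$ acts on $\mathcal P$ by $g\alpha=\{gA:A\in\alpha\}$. $\alpha\vee\beta=\{A\cap B\}$; $\beta\le\alpha$ ($\alpha$ refines $\beta$) means every atom of $\alpha$ is contained up to a null set in an atom of $\beta$. For finite $F\subset G$, $\alpha^F=\bigvee_{g\in F}g\alpha$. The left Cayley graph of $(G,S)$ has vertex set $G$ and a directed edge from $g$ to $sg$ for each $g\in G$, $s\in S$; a set $F\subset G$ is $S$-connected if its induced subgraph is connected as an undirected graph. Partitions $\alpha,\beta\in\mathcal P$ are $S$-equivalent if there are finite $S$-connected sets $F_1,F_2\subset G$ containing the identity $e$ with $\alpha\le\beta^{F_1}$ and $\beta\le\alpha^{F_2}$. A partition $\alpha$ is generating if every measurable set agrees up to a null set with a set in the smallest $G$-invariant $\sigma$-algebra containing the atoms of $\alpha$. *)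

theory Defs
  imports "HOL-Probability.Probability" "HOL-Algebra.Generated_Groups"
begin

text \<open>A G-system: a measure-preserving action T of the group G on the probability space M.\<close>
definition G_system :: "('g, 'b) monoid_scheme \<Rightarrow> 'a measure \<Rightarrow> ('g \<Rightarrow> 'a \<Rightarrow> 'a) \<Rightarrow> bool" where
  "G_system G M T \<longleftrightarrow> group G \<and> prob_space M \<and>
     (\<forall>g\<in>carrier G. T g \<in> measurable M M \<and> distr M M (T g) = M) \<and>
     (\<forall>x\<in>space M. T \<one>\<^bsub>G\<^esub> x = x) \<and>
     (\<forall>g\<in>carrier G. \<forall>h\<in>carrier G. \<forall>x\<in>space M. T (g \<otimes>\<^bsub>G\<^esub> h) x = T g (T h x))"

text \<open>Image gA of a set under g, written as the preimage under g^{-1} (equal to T g ` A).\<close>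
definition act_set :: "('g, 'b) monoid_scheme \<Rightarrow> 'a measure \<Rightarrow> ('g \<Rightarrow> 'a \<Rightarrow> 'a) \<Rightarrow> 'g \<Rightarrow> 'a set \<Rightarrow> 'a set" where
  "act_set G M T g A = T (inv\<^bsub>G\<^esub> g) -` A \<inter> space M"

definition act_part :: "('g, 'b) monoid_scheme \<Rightarrow> 'a measure \<Rightarrow> ('g \<Rightarrow> 'a \<Rightarrow> 'a) \<Rightarrow> 'g \<Rightarrow> 'a set set \<Rightarrow> 'a set set" where
  "act_part G M T g \<alpha> = act_set G M T g ` \<alpha>"

text \<open>Entropy H(alpha) = - sum mu(A) log mu(A).\<close>
definition ent_term :: "real \<Rightarrow> real" where
  "ent_term p = (if p = 0 then 0 else - p * ln p)"

definition entropy_part :: "'a measure \<Rightarrow> 'a set set \<Rightarrow> real" where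
  "entropy_part M \<alpha> = (\<Sum>\<^sub>\<infinity>A\<in>\<alpha>. ent_term (measure M A))"

text \<open>The class P: countable measurable partitions of finite entropy.\<close>
definition fin_ent_part :: "'a measure \<Rightarrow> 'a set set \<Rightarrow> bool" where
  "fin_ent_part M \<alpha> \<longleftrightarrow> countable \<alpha> \<and> \<alpha> \<subseteq> sets M \<and> disjoint \<alpha> \<and> \<Union>\<alpha> = space M \<and>
     (\<lambda>A. ent_term (measure M A)) summable_on \<alpha>"

text \<open>Conditional entropy H(alpha|beta) = - sum mu(A \<inter> B) log (mu(A \<inter> B)/mu(B)).\<close>
definition cond_entropy :: "'a measure \<Rightarrow> 'a set set \<Rightarrow> 'a set set \<Rightarrow> real" where
  "cond_entropy M \<alpha> \<beta> = (\<Sum>\<^sub>\<infinity>(A, B)\<in>\<alpha> \<times> \<beta>.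
      (if measure M (A \<inter> B) = 0 then 0
       else - measure M (A \<inter> B) * ln (measure M (A \<inter> B) / measure M B)))"

definition rohlin_dist :: "'a measure \<Rightarrow> 'a set set \<Rightarrow> 'a set set \<Rightarrow> real" where
  "rohlin_dist M \<alpha> \<beta> = cond_entropy M \<alpha> \<beta> + cond_entropy M \<beta> \<alpha>"

text \<open>beta \<le> alpha (alpha refines beta): every atom of alpha lies, up to a null set, in an atom of beta.\<close>
definition part_le :: "'a measure \<Rightarrow> 'a set set \<Rightarrow> 'a set set \<Rightarrow> bool" where
  "part_le M \<beta> \<alpha> \<longleftrightarrow> (\<forall>A\<in>\<alpha>. \<exists>B\<in>\<beta>. measure M (A - B) = 0)"

text \<open>alpha^F = join over g in F of g alpha (F finite, nonempty).\<close>
definition join_over :: "('g, 'b) monoid_scheme \<Rightarrow> 'a measure \<Rightarrow> ('g \<Rightarrow> 'a \<Rightarrow> 'a) \<Rightarrow> 'g set \<Rightarrow> 'a set set \<Rightarrow> 'a set set" where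
  "join_over G M T F \<alpha> =
     {space M \<inter> (\<Inter>g\<in>F. c g) | c. \<forall>g\<in>F. c g \<in> act_part G M T g \<alpha>}"

text \<open>F is S-connected: its induced subgraph in the left Cayley graph (edges g -- s g) is connected.\<close>
definition cayley_edges_on :: "('g, 'b) monoid_scheme \<Rightarrow> 'g set \<Rightarrow> 'g set \<Rightarrow> ('g \<times> 'g) set" where
  "cayley_edges_on G S F = {(g, h). g \<in> F \<and> h \<in> F \<and>
      (\<exists>s\<in>S. h = s \<otimes>\<^bsub>G\<^esub> g \<or> g = s \<otimes>\<^bsub>G\<^esub> h)}"

definition S_connected :: "('g, 'b) monoid_scheme \<Rightarrow> 'g set \<Rightarrow> 'g set \<Rightarrow> bool" where
  "S_connected G S F \<longleftrightarrow> (\<forall>g\<in>F. \<forall>h\<in>F. (g, h) \<in> (cayley_edges_on G S F)\<^sup>*)"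

definition S_equivalent :: "('g, 'b) monoid_scheme \<Rightarrow> 'a measure \<Rightarrow> ('g \<Rightarrow> 'a \<Rightarrow> 'a) \<Rightarrow> 'g set \<Rightarrow> 'a set set \<Rightarrow> 'a set set \<Rightarrow> bool" where
  "S_equivalent G M T S \<alpha> \<beta> \<longleftrightarrow>
     (\<exists>F1 F2. finite F1 \<and> finite F2 \<and> F1 \<subseteq> carrier G \<and> F2 \<subseteq> carrier G \<and>
        \<one>\<^bsub>G\<^esub> \<in> F1 \<and> \<one>\<^bsub>G\<^esub> \<in> F2 \<and> S_connected G S F1 \<and> S_connected G S F2 \<and>
        part_le M \<alpha> (join_over G M T F1 \<beta>) \<and> part_le M \<beta> (join_over G M T F2 \<alpha>))"

text \<open>The smallest G-invariant sigma-algebra (on space M) containing the atoms of alpha.\<close>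
definition inv_sigma :: "('g, 'b) monoid_scheme \<Rightarrow> 'a measure \<Rightarrow> ('g \<Rightarrow> 'a \<Rightarrow> 'a) \<Rightarrow> 'a set set \<Rightarrow> 'a set set" where
  "inv_sigma G M T \<alpha> = \<Inter>{\<Sigma>. sigma_algebra (space M) \<Sigma> \<and> \<alpha> \<subseteq> \<Sigma> \<and>
       (\<forall>g\<in>carrier G. \<forall>A\<in>\<Sigma>. act_set G M T g A \<in> \<Sigma>)}"

definition generating :: "('g, 'b) monoid_scheme \<Rightarrow> 'a measure \<Rightarrow> ('g \<Rightarrow> 'a \<Rightarrow> 'a) \<Rightarrow> 'a set set \<Rightarrow> bool" where
  "generating G M T \<alpha> \<longleftrightarrow>
     (\<forall>A\<in>sets M. \<exists>B\<in>inv_sigma G M T \<alpha>. B \<in> sets M \<and> measure M (A - B) + measure M (B - A) = 0)"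

end

theory Submission
  imports Defs
begin

text \<open>
  As \<open>\<alpha>\<close> is generating, a finite truncation of \<open>\<beta>\<close> is approximated in measure by a finite-valued
  function \<open>b\<close> that is constant on the atoms of some \<open>\<alpha>\<^sup>F\<close>. As \<open>\<beta>\<close> is generating, the atom of \<open>\<alpha>\<close>
  containing \<open>x\<close> can be guessed from the values \<open>b (g\<^sup>-\<^sup>1x)\<close>, for \<open>g\<close> in a finite set \<open>L\<close>, with an
  error set \<open>E\<close> of small measure. The partition \<open>\<alpha>'\<close> records \<open>b\<close>, membership in \<open>E\<close>, and on \<open>E\<close> also the
  atom of \<open>\<alpha>\<close>. By construction \<open>\<alpha>'\<^sup>L\<close> refines \<open>\<alpha>\<close>, and \<open>\<alpha>'\<close> is determined by \<open>\<alpha>\<close> over a finite set.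
  Both conditional entropies are bounded by Gibbs' inequality with a kernel that puts mass \<open>1 - t\<close> on
  the guess; the remaining cost is the integral of an integrable information function over a small set.
  The set \<open>L\<close> is chosen before the truncation of \<open>\<beta>\<close>, and the quality of \<open>b\<close> last.
\<close>

section \<open>Atoms and information functions\<close>

text \<open>Kept apart from \<open>fin_ent_part\<close> because the fibre partition built below is
  handled before its entropy is known to be finite.\<close>

definition mpart :: "'a measure \<Rightarrow> 'a set set \<Rightarrow> bool" where
  "mpart M \<xi> \<longleftrightarrow> countable \<xi> \<and> \<xi> \<subseteq> sets M \<and> disjoint \<xi> \<and> \<Union>\<xi> = space M"

definition atom :: "'a set set \<Rightarrow> 'a \<Rightarrow> 'a set" where
  "atom \<xi> x = (THE C. C \<in> \<xi> \<and> x \<in> C)"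

lemma fin_ent_part_mpart: "fin_ent_part M \<xi> \<Longrightarrow> mpart M \<xi>"
  by (auto simp: fin_ent_part_def mpart_def)

lemma mpart_sets: "mpart M \<xi> \<Longrightarrow> C \<in> \<xi> \<Longrightarrow> C \<in> sets M"
  by (auto simp: mpart_def)

lemma atom_eq:
  assumes "mpart M \<xi>" "C \<in> \<xi>" "x \<in> C"
  shows "atom \<xi> x = C"
  unfolding atom_def
  by (rule the_equality) (use assms in \<open>auto simp: mpart_def disjoint_def\<close>)

lemma atom_in:
  assumes "mpart M \<xi>" "x \<in> space M"
  shows "atom \<xi> x \<in> \<xi>" "x \<in> atom \<xi> x"
proof -
  obtain C where "C \<in> \<xi>" "x \<in> C"
    using assms by (auto simp: mpart_def)
  then show "atom \<xi> x \<in> \<xi>" "x \<in> atom \<xi> x"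
    using atom_eq[OF assms(1)] by auto
qed

lemma atom_eq_iff:
  assumes "mpart M \<xi>" "C \<in> \<xi>" "x \<in> space M"
  shows "atom \<xi> x = C \<longleftrightarrow> x \<in> C"
  using atom_eq[OF assms(1,2)] atom_in[OF assms(1,3)] by auto

lemma measurable_atom:
  assumes "mpart M \<xi>"
  shows "atom \<xi> \<in> measurable M (count_space \<xi>)"
proof -
  have "atom \<xi> -` {C} \<inter> space M \<in> sets M" if "C \<in> \<xi>" for C
  proof -
    have "atom \<xi> -` {C} \<inter> space M = C \<inter> space M"
      using atom_eq_iff[OF assms that] by auto
    then show ?thesis
      using mpart_sets[OF assms that] by auto
  qed
  moreover have "countable \<xi>"
    using assms by (simp add: mpart_def)
  ultimately show ?thesis
    using atom_in(1)[OF assms] by (subst measurable_count_space_eq_countable) auto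
qed

lemma borel_measurable_atom:
  "mpart M \<xi> \<Longrightarrow> (\<lambda>x. f (atom \<xi> x)) \<in> borel_measurable M"
  by (rule measurable_compose[OF measurable_atom]) auto

text \<open>A bridge between the unordered sums in the definitions of entropy and integrals against
  counting measure, where countable additivity and Tonelli are available.\<close>

lemma has_sum_eq_nn_integral:
  fixes f :: "'i \<Rightarrow> real"
  assumes "\<And>i. i \<in> I \<Longrightarrow> 0 \<le> f i" "0 \<le> s"
    and "(\<integral>\<^sup>+i. ennreal (f i) \<partial>count_space I) = ennreal s"
  shows "(f has_sum s) I"
proof -
  have int: "integrable (count_space I) f"
    by (rule integrableI_nn_integral_finite[where x = s]) (use assms in \<open>auto simp: AE_count_space\<close>)
  then have "integral\<^sup>L (count_space I) f = s"
    using assms by (subst integral_eq_nn_integral) (auto simp: AE_count_space)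
  moreover have ab: "Infinite_Set_Sum.abs_summable_on f I"
    using int by (simp add: Infinite_Set_Sum.abs_summable_on_def)
  ultimately have "infsum f I = s"
    using infsetsum_infsum[OF ab] by (simp add: infsetsum_def)
  moreover have "f summable_on I"
    using ab abs_summable_equivalent abs_summable_summable by blast
  ultimately show ?thesis
    using has_sum_infsum by metis
qed

lemma (in finite_measure) has_sum_measure_UN:
  assumes "countable I" "\<And>i. i \<in> I \<Longrightarrow> X i \<in> sets M" "disjoint_family_on X I"
  shows "((\<lambda>i. measure M (X i)) has_sum measure M (\<Union>i\<in>I. X i)) I"
proof (rule has_sum_eq_nn_integral)
  have "(\<integral>\<^sup>+i. ennreal (measure M (X i)) \<partial>count_space I) = emeasure M (\<Union>i\<in>I. X i)"
    using assms by (subst emeasure_UN_countable) (auto simp: emeasure_eq_measure)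
  then show "(\<integral>\<^sup>+i. ennreal (measure M (X i)) \<partial>count_space I) = ennreal (measure M (\<Union>i\<in>I. X i))"
    by (simp add: emeasure_eq_measure)
qed auto

lemma summable_imp_nn_integral_finite:
  fixes f :: "'i \<Rightarrow> real"
  assumes "\<And>i. i \<in> I \<Longrightarrow> 0 \<le> f i" "f summable_on I"
  shows "(\<integral>\<^sup>+i. ennreal (f i) \<partial>count_space I) < \<infinity>"
proof -
  have "Infinite_Set_Sum.abs_summable_on f I"
    using assms abs_summable_equivalent summable_on_iff_abs_summable_on_real by blast
  then have "integrable (count_space I) f"
    by (simp add: Infinite_Set_Sum.abs_summable_on_def)
  then have "(\<integral>\<^sup>+i. ennreal (norm (f i)) \<partial>count_space I) < \<infinity>"
    by (simp add: integrable_iff_bounded)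
  moreover have "(\<integral>\<^sup>+i. ennreal (norm (f i)) \<partial>count_space I) = (\<integral>\<^sup>+i. ennreal (f i) \<partial>count_space I)"
    by (rule nn_integral_cong) (use assms in auto)
  ultimately show ?thesis by simp
qed

text \<open>Write \<open>f (atom \<xi> x)\<close> as the sum over \<open>C\<close> of
  \<open>f C * indicator C x\<close> and exchange sum and integral by Tonelli.\<close>

lemma nn_integral_atom:
  assumes "mpart M \<xi>"
  shows "(\<integral>\<^sup>+x. f (atom \<xi> x) \<partial>M) = (\<integral>\<^sup>+C. f C * emeasure M C \<partial>count_space \<xi>)"
proof -
  have "(\<integral>\<^sup>+C. f C * indicator C x \<partial>count_space \<xi>) = f (atom \<xi> x)" if "x \<in> space M" for x
  proof -
    have "f C * indicator C x = f (atom \<xi> x) * indicator {atom \<xi> x} C" if "C \<in> \<xi>" for C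
      using atom_eq_iff[OF assms that \<open>x \<in> space M\<close>] by (cases "x \<in> C") auto
    then have "(\<integral>\<^sup>+C. f C * indicator C x \<partial>count_space \<xi>)
        = (\<integral>\<^sup>+C. f (atom \<xi> x) * indicator {atom \<xi> x} C \<partial>count_space \<xi>)"
      by (intro nn_integral_cong) simp
    then show ?thesis
      using atom_in[OF assms that] by (simp add: nn_integral_cmult)
  qed
  then have "(\<integral>\<^sup>+x. f (atom \<xi> x) \<partial>M) = (\<integral>\<^sup>+x. \<integral>\<^sup>+C. f C * indicator C x \<partial>count_space \<xi> \<partial>M)"
    by (intro nn_integral_cong) simp
  also have "\<dots> = (\<integral>\<^sup>+C. \<integral>\<^sup>+x. f C * indicator C x \<partial>M \<partial>count_space \<xi>)"
    using assms by (intro nn_integral_count_space_nn_integral) (auto simp: mpart_def)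
  also have "\<dots> = (\<integral>\<^sup>+C. f C * emeasure M C \<partial>count_space \<xi>)"
    using mpart_sets[OF assms] by (intro nn_integral_cong) (auto simp: nn_integral_cmult_indicator)
  finally show ?thesis .
qed

text \<open>The information function of \<open>\<xi>\<close>, whose integral is the entropy. On null
  atoms the convention \<open>ln 0 = 0\<close> makes it 0.\<close>

definition info :: "'a measure \<Rightarrow> 'a set set \<Rightarrow> 'a \<Rightarrow> real" where
  "info M \<xi> x = - ln (measure M (atom \<xi> x))"

context prob_space
begin

lemma neg_ln_measure_nonneg: "0 \<le> - ln (measure M A)"
  using prob_le_1[of A] by (cases "measure M A = 0") (auto simp: zero_less_measure_iff)

lemma info_nonneg: "0 \<le> info M \<xi> x"
  unfolding info_def by (rule neg_ln_measure_nonneg)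

lemma integrable_info:
  assumes "fin_ent_part M \<xi>"
  shows "integrable M (info M \<xi>)"
proof -
  note P = fin_ent_part_mpart[OF assms]
  have "(\<integral>\<^sup>+x. ennreal (info M \<xi> x) \<partial>M)
      = (\<integral>\<^sup>+C. ennreal (ent_term (measure M C)) \<partial>count_space \<xi>)"
    unfolding info_def nn_integral_atom[OF P, of "\<lambda>C. ennreal (- ln (measure M C))"]
  proof (intro nn_integral_cong)
    fix C
    show "ennreal (- ln (measure M C)) * emeasure M C = ennreal (ent_term (measure M C))"
      unfolding emeasure_eq_measure ent_term_def
      using neg_ln_measure_nonneg[of C] by (subst ennreal_mult[symmetric]) (auto simp: mult.commute)
  qed
  also have "\<dots> < \<infinity>"
  proof (rule summable_imp_nn_integral_finite)
    fix C
    show "0 \<le> ent_term (measure M C)"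
      using mult_nonneg_nonneg[OF measure_nonneg neg_ln_measure_nonneg, of M C C]
      by (auto simp: ent_term_def)
  qed (use assms in \<open>simp add: fin_ent_part_def\<close>)
  finally show ?thesis
    using info_nonneg borel_measurable_atom[OF P, of "\<lambda>C. - ln (measure M C)"]
    by (intro integrableI_bounded) (auto simp: info_def[abs_def])
qed

text \<open>Absolute continuity of the integral. Cut \<open>f\<close> at a height \<open>n\<close>:
  dominated convergence makes the integral of the excess small, and the bounded part contributes at
  most \<open>n\<close> times the measure of \<open>D\<close>.\<close>

lemma set_integral_small:
  fixes f :: "'a \<Rightarrow> real"
  assumes "integrable M f" "\<And>x. 0 \<le> f x" "0 < \<epsilon>"
  obtains \<delta> where "0 < \<delta>"
    "\<And>D. D \<in> sets M \<Longrightarrow> measure M D < \<delta> \<Longrightarrow> (\<integral>x. indicator D x * f x \<partial>M) < \<epsilon>"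
proof -
  have [measurable]: "f \<in> borel_measurable M"
    using assms(1) by auto
  have "(\<lambda>n. \<integral>x. max 0 (f x - real n) \<partial>M) \<longlonglongrightarrow> (\<integral>x. 0 \<partial>M)"
  proof (rule integral_dominated_convergence[where w = f])
    have "(\<lambda>n. max 0 (f x - real n)) \<longlonglongrightarrow> 0" for x
    proof (rule tendsto_eventually)
      obtain N where "f x \<le> real N" using real_arch_simple by blast
      then show "\<forall>\<^sub>F n in sequentially. max 0 (f x - real n) = 0"
        by (intro eventually_sequentiallyI[of N]) auto
    qed
    then show "AE x in M. (\<lambda>n. max 0 (f x - real n)) \<longlonglongrightarrow> 0" by simp
  qed (use assms in auto)
  then have "\<forall>\<^sub>F n in sequentially. (\<integral>x. max 0 (f x - real n) \<partial>M) < \<epsilon> / 2"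
    using assms(3) by (intro order_tendstoD) auto
  then obtain n :: nat where n: "(\<integral>x. max 0 (f x - real n) \<partial>M) < \<epsilon> / 2"
    by (auto simp: eventually_sequentially)
  show thesis
  proof
    \<comment> \<open>Dividing by \<open>n + 1\<close> instead of \<open>n\<close> covers
      \<open>n = 0\<close>.\<close>
    show "0 < \<epsilon> / (2 * (real n + 1))" using assms(3) by simp
    fix D assume [measurable]: "D \<in> sets M" and D: "measure M D < \<epsilon> / (2 * (real n + 1))"
    have i1: "integrable M (\<lambda>x. max 0 (f x - real n))"
      by (rule Bochner_Integration.integrable_bound[OF assms(1)]) (use assms(2) in auto)
    have i2: "integrable M (\<lambda>x. real n * indicator D x)"
      by (intro integrable_mult_right integrable_real_indicator) (auto simp: emeasure_eq_measure)
    have i3: "integrable M (\<lambda>x. indicator D x * f x)"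
      by (rule Bochner_Integration.integrable_bound[OF assms(1)])
        (use assms(2) in \<open>auto simp: indicator_def\<close>)
    have "(\<integral>x. indicator D x * f x \<partial>M) \<le> (\<integral>x. max 0 (f x - real n) + real n * indicator D x \<partial>M)"
      using i1 i2 i3 assms(2) by (intro integral_mono) (auto simp: indicator_def)
    also have "\<dots> = (\<integral>x. max 0 (f x - real n) \<partial>M) + real n * measure M D"
      using i1 i2 by simp
    also have "\<dots> < \<epsilon> / 2 + \<epsilon> / 2"
    proof -
      have "real n * measure M D \<le> (real n + 1) * measure M D"
        by (intro mult_right_mono) auto
      also have "\<dots> < \<epsilon> / 2"
        using D by (simp add: field_simps)
      finally show ?thesis using n by simp
    qed
    finally show "(\<integral>x. indicator D x * f x \<partial>M) < \<epsilon>" by simp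
  qed
qed

end

section \<open>Gibbs' inequality for conditional entropy\<close>

text \<open>The kernel \<open>q\<close> is a guess for the conditional probability of
  \<open>C\<close> given \<open>B\<close>. Since \<open>ln u \<le> u - 1\<close>, coding with a
  guess of total mass at most 1 costs on average at least the conditional entropy. \<open>Q\<close>
  majorizes the code length pointwise, so that every cost becomes an integral. Summability is a
  separate conclusion because \<open>infsum\<close> is 0 by default on a divergent family; it later
  gives finite entropy.\<close>

lemma (in prob_space) gibbs_bound:
  assumes X: "mpart M \<xi>" and Y: "mpart M \<eta>"
    and q0: "\<And>C B. 0 \<le> q C B"
    and q1: "\<And>K B. finite K \<Longrightarrow> K \<subseteq> \<xi> \<Longrightarrow> B \<in> \<eta> \<Longrightarrow> (\<Sum>C\<in>K. q C B) \<le> 1"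
    and Q: "integrable M Q" "\<And>x. x \<in> space M \<Longrightarrow> 0 \<le> Q x"
    and qQ: "\<And>x. x \<in> space M \<Longrightarrow> 0 < measure M (atom \<xi> x \<inter> atom \<eta> x) \<Longrightarrow>
      0 < q (atom \<xi> x) (atom \<eta> x) \<and> - ln (q (atom \<xi> x) (atom \<eta> x)) \<le> Q x"
  shows "(\<lambda>(C, B). if measure M (C \<inter> B) = 0 then 0
           else - measure M (C \<inter> B) * ln (measure M (C \<inter> B) / measure M B)) summable_on \<xi> \<times> \<eta>"
      (is "?t summable_on _")
    and "cond_entropy M \<xi> \<eta> \<le> (\<integral>x. Q x \<partial>M)"
proof -
  \<comment> \<open>\<open>p\<close> is the true joint law, \<open>s\<close> the joint law suggested
    by the kernel, and \<open>r\<close> the cross-entropy term.\<close>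
  define p where "p = (\<lambda>(C, B). measure M (C \<inter> B))"
  define r where "r = (\<lambda>(C, B). - measure M (C \<inter> B) * ln (q C B))"
  define s where "s = (\<lambda>(C, B). q C B * measure M B)"
  have cnt: "countable \<xi>" "countable \<eta>" and sX: "\<xi> \<subseteq> sets M" and sY: "\<eta> \<subseteq> sets M"
    and uX: "\<Union>\<xi> = space M" and uY: "\<Union>\<eta> = space M"
    using X Y by (auto simp: mpart_def)
  have disj: "disjoint_family_on (\<lambda>(C, B). C \<inter> B) (\<xi> \<times> \<eta>)"
    unfolding disjoint_family_on_def
    using atom_eq[OF X] atom_eq[OF Y] by (clarsimp simp: disjoint_iff) metis
  have q_le1: "q C B \<le> 1" if "C \<in> \<xi>" "B \<in> \<eta>" for C B
    using q1[of "{C}" B] that by simp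
  have ptq: "0 < q C B \<and> - ln (q C B) \<le> Q x"
    if "C \<in> \<xi>" "B \<in> \<eta>" "x \<in> C" "x \<in> B" "0 < measure M (C \<inter> B)" for C B x
    using qQ[of x] that atom_eq[OF X, of C x] atom_eq[OF Y, of B x] uX by auto
  have qpos: "0 < q C B" if CB: "C \<in> \<xi>" "B \<in> \<eta>" "0 < measure M (C \<inter> B)" for C B
  proof -
    have "C \<inter> B \<noteq> {}" using CB(3) by auto
    then show ?thesis using ptq CB by blast
  qed
  have p_sum: "(p has_sum 1) (\<xi> \<times> \<eta>)"
  proof -
    have "(\<Union>(C, B)\<in>\<xi> \<times> \<eta>. C \<inter> B) = space M"
      using uX uY by blast
    moreover have "((\<lambda>i. measure M ((\<lambda>(C, B). C \<inter> B) i)) has_sum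
        measure M (\<Union>i\<in>\<xi> \<times> \<eta>. (\<lambda>(C, B). C \<inter> B) i)) (\<xi> \<times> \<eta>)"
      by (rule has_sum_measure_UN) (use cnt sX sY disj in auto)
    ultimately show ?thesis
      by (simp add: p_def prob_space case_prod_unfold)
  qed
  have r_nonneg: "0 \<le> r i" if i: "i \<in> \<xi> \<times> \<eta>" for i
  proof -
    obtain C B where [simp]: "i = (C, B)" and CB: "C \<in> \<xi>" "B \<in> \<eta>" using i by auto
    show ?thesis
    proof (cases "measure M (C \<inter> B) = 0")
      case False
      then have "0 < q C B" using qpos[OF CB] by (simp add: zero_less_measure_iff)
      then show ?thesis using q_le1[OF CB] by (auto simp: r_def intro!: mult_nonneg_nonpos)
    qed (simp add: r_def)
  qed
  \<comment> \<open>Each term of \<open>r\<close> is the integral of a constant over its cell, where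
    \<open>Q\<close> dominates that constant. The cells are disjoint, so these integrals add up to
    at most the integral of \<open>Q\<close>.\<close>
  have r_bound: "sum r K \<le> (\<integral>x. Q x \<partial>M)" if K: "finite K" "K \<subseteq> \<xi> \<times> \<eta>" for K
  proof -
    have Km: "(case i of (C, B) \<Rightarrow> C \<inter> B) \<in> sets M" if "i \<in> K" for i
      using that K(2) sX sY by (cases i) auto
    have qint: "integrable M (\<lambda>x. indicator (case i of (C, B) \<Rightarrow> C \<inter> B) x * Q x)" if "i \<in> K" for i
      using integrable_mult_indicator[OF Km[OF that] Q(1)] by simp
    have "r i \<le> (\<integral>x. indicator (case i of (C, B) \<Rightarrow> C \<inter> B) x * Q x \<partial>M)" if i: "i \<in> K" for i
    proof -
      obtain C B where [simp]: "i = (C, B)" and CB: "C \<in> \<xi>" "B \<in> \<eta>" using i K by auto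
      have CBm: "C \<inter> B \<in> sets M" using CB sX sY by auto
      show ?thesis
      proof (cases "measure M (C \<inter> B) = 0")
        case True
        moreover have "0 \<le> (\<integral>x. indicator (C \<inter> B) x * Q x \<partial>M)"
          using Q(2) by (intro Bochner_Integration.integral_nonneg_AE AE_I2) auto
        ultimately show ?thesis by (simp add: r_def)
      next
        case False
        then have pos: "0 < measure M (C \<inter> B)" by (simp add: zero_less_measure_iff)
        have "r i = (\<integral>x. indicator (C \<inter> B) x * - ln (q C B) \<partial>M)"
          using CBm sets.sets_into_space[OF CBm] by (simp add: r_def Int_absorb2)
        also have "\<dots> \<le> (\<integral>x. indicator (C \<inter> B) x * Q x \<partial>M)"
        proof (rule integral_mono)
          show "integrable M (\<lambda>x. indicator (C \<inter> B) x * - ln (q C B))"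
            using CBm by (intro integrable_mult_left integrable_real_indicator)
              (auto simp: emeasure_eq_measure)
          show "integrable M (\<lambda>x. indicator (C \<inter> B) x * Q x)"
            using qint[OF i] by simp
          show "indicator (C \<inter> B) x * - ln (q C B) \<le> indicator (C \<inter> B) x * Q x"
            if "x \<in> space M" for x
            using ptq[OF CB _ _ pos, of x] by (auto simp: indicator_def)
        qed
        finally show ?thesis by simp
      qed
    qed
    then have "sum r K \<le> (\<Sum>i\<in>K. \<integral>x. indicator (case i of (C, B) \<Rightarrow> C \<inter> B) x * Q x \<partial>M)"
      by (rule sum_mono)
    also have "\<dots> = (\<integral>x. (\<Sum>i\<in>K. indicator (case i of (C, B) \<Rightarrow> C \<inter> B) x * Q x) \<partial>M)"
      using qint by (rule Bochner_Integration.integral_sum[symmetric])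
    also have "\<dots> \<le> (\<integral>x. Q x \<partial>M)"
    proof (rule integral_mono)
      show "integrable M (\<lambda>x. \<Sum>i\<in>K. indicator (case i of (C, B) \<Rightarrow> C \<inter> B) x * Q x)"
        using qint by (rule Bochner_Integration.integrable_sum)
      fix x assume x: "x \<in> space M"
      have "(\<Sum>i\<in>K. indicator (case i of (C, B) \<Rightarrow> C \<inter> B) x) = (indicator (\<Union>i\<in>K. case i of (C, B) \<Rightarrow> C \<inter> B) x :: real)"
        using K(1) disjoint_family_on_mono[OF K(2) disj] by (intro indicator_UN_disjoint[symmetric])
      then have "(\<Sum>i\<in>K. indicator (case i of (C, B) \<Rightarrow> C \<inter> B) x * Q x)
          = indicator (\<Union>i\<in>K. case i of (C, B) \<Rightarrow> C \<inter> B) x * Q x"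
        by (simp add: sum_distrib_right[symmetric])
      also have "\<dots> \<le> Q x"
        using Q(2)[OF x] by (auto simp: indicator_def)
      finally show "(\<Sum>i\<in>K. indicator (case i of (C, B) \<Rightarrow> C \<inter> B) x * Q x) \<le> Q x" .
    qed (fact Q(1))
    finally show ?thesis .
  qed
  have r_sum: "r summable_on \<xi> \<times> \<eta>"
    using r_nonneg r_bound by (intro nonneg_bdd_above_summable_on) (auto intro!: bdd_aboveI)
  have s_nonneg: "0 \<le> s i" for i
    using q0 by (simp add: s_def case_prod_unfold)
  have s_bound: "sum s K \<le> 1" if K: "finite K" "K \<subseteq> \<xi> \<times> \<eta>" for K
  proof -
    \<comment> \<open>Enlarging \<open>K\<close> to a rectangle lets \<open>q1\<close> be applied
      for each \<open>B\<close> separately.\<close>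
    have "sum s K \<le> sum s (fst ` K \<times> snd ` K)"
      using K(1) s_nonneg by (intro sum_mono2 subset_fst_snd) simp_all
    also have "\<dots> = (\<Sum>B\<in>snd ` K. \<Sum>C\<in>fst ` K. q C B * measure M B)"
      unfolding s_def sum.cartesian_product[symmetric] by (rule sum.swap)
    also have "\<dots> \<le> (\<Sum>B\<in>snd ` K. measure M B)"
    proof (rule sum_mono)
      fix B assume "B \<in> snd ` K"
      then have "(\<Sum>C\<in>fst ` K. q C B) \<le> 1" using K by (intro q1) auto
      then show "(\<Sum>C\<in>fst ` K. q C B * measure M B) \<le> measure M B"
        by (simp add: sum_distrib_right[symmetric] mult_left_le_one_le sum_nonneg q0)
    qed
    also have "\<dots> = measure M (\<Union>B\<in>snd ` K. B)"
    proof (rule finite_measure_finite_Union[symmetric])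
      have sK: "snd ` K \<subseteq> \<eta>" using K by auto
      then show "(\<lambda>B. B) ` snd ` K \<subseteq> sets M"
        using sY by blast
      have "disjoint_family_on (\<lambda>B. B) \<eta>"
        using Y by (simp add: disjoint_family_on_def mpart_def disjoint_def)
      then show "disjoint_family_on (\<lambda>B. B) (snd ` K)"
        by (rule disjoint_family_on_mono[OF sK])
    qed (use K in simp)
    also have "\<dots> \<le> 1" by simp
    finally show ?thesis .
  qed
  have s_sum: "s summable_on \<xi> \<times> \<eta>"
    using s_bound s_nonneg by (intro nonneg_bdd_above_summable_on) (auto intro!: bdd_aboveI)
  have t_le: "?t i \<le> r i + s i - p i" if i: "i \<in> \<xi> \<times> \<eta>" for i
  proof -
    obtain C B where [simp]: "i = (C, B)" and CB: "C \<in> \<xi>" "B \<in> \<eta>" using i by auto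
    show ?thesis
    proof (cases "measure M (C \<inter> B) = 0")
      case True
      then show ?thesis using q0 by (simp add: r_def s_def p_def)
    next
      case False
      define a b where "a = measure M (C \<inter> B)" and "b = measure M B"
      have a: "0 < a" using False by (simp add: a_def zero_less_measure_iff)
      have "a \<le> b" unfolding a_def b_def using CB sY by (intro finite_measure_mono) auto
      then have b: "0 < b" using a by simp
      have q: "0 < q C B" using qpos[OF CB] a by (simp add: a_def)
      \<comment> \<open>The tangent bound is taken at the ratio of guessed to true joint mass;
        multiplied by \<open>a\<close> it leaves exactly the correction
        \<open>s - p\<close>.\<close>
      have "ln (q C B * b / a) \<le> q C B * b / a - 1"
        using a b q by (intro ln_le_minus_one) simp
      then have "a * ln (q C B * b / a) \<le> a * (q C B * b / a - 1)"
        using a by (intro mult_left_mono) auto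
      also have "\<dots> = q C B * b - a"
        using a by (simp add: field_simps)
      also have "ln (q C B * b / a) = ln (q C B) - ln (a / b)"
        using a b q by (simp add: ln_mult ln_div)
      finally show ?thesis
        using False by (simp add: r_def s_def p_def a_def[symmetric] b_def[symmetric] algebra_simps)
    qed
  qed
  have t_nonneg: "0 \<le> ?t i" if i: "i \<in> \<xi> \<times> \<eta>" for i
  proof -
    obtain C B where [simp]: "i = (C, B)" and CB: "C \<in> \<xi>" "B \<in> \<eta>" using i by auto
    have le: "measure M (C \<inter> B) \<le> measure M B"
      using CB sY by (intro finite_measure_mono) auto
    have "ln (measure M (C \<inter> B) / measure M B) \<le> 0" if "measure M (C \<inter> B) \<noteq> 0"
    proof -
      have "0 < measure M (C \<inter> B)" using that by (simp add: zero_less_measure_iff)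
      then show ?thesis using le by (simp add: divide_le_eq_1)
    qed
    then show ?thesis by (auto intro!: mult_nonneg_nonpos)
  qed
  have u_sum: "((\<lambda>i. r i + s i + - p i) has_sum infsum r (\<xi> \<times> \<eta>) + infsum s (\<xi> \<times> \<eta>) + - 1) (\<xi> \<times> \<eta>)"
    by (intro has_sum_add has_sum_infsum r_sum s_sum has_sum_uminusI p_sum)
  show t_sum: "?t summable_on \<xi> \<times> \<eta>"
    by (rule summable_on_comparison_test[OF has_sum_imp_summable[OF u_sum]])
      (use t_le t_nonneg in auto)
  have "cond_entropy M \<xi> \<eta> \<le> infsum r (\<xi> \<times> \<eta>) + infsum s (\<xi> \<times> \<eta>) + - 1"
    unfolding cond_entropy_def
    by (rule has_sum_mono[OF has_sum_infsum[OF t_sum] u_sum]) (use t_le in auto)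
  \<comment> \<open>\<open>s\<close> has total mass at most 1 and \<open>p\<close> has total mass 1,
    so the correction is not positive.\<close>
  also have "\<dots> \<le> (\<integral>x. Q x \<partial>M) + 1 - 1"
    using infsum_le_finite_sums[OF r_sum r_bound] infsum_le_finite_sums[OF s_sum s_bound] by simp
  finally show "cond_entropy M \<xi> \<eta> \<le> (\<integral>x. Q x \<partial>M)" by simp
qed

section \<open>Connected sets and cylinder sets\<close>

lemma cayley_edges_on_mono: "F \<subseteq> F' \<Longrightarrow> cayley_edges_on G S F \<subseteq> cayley_edges_on G S F'"
  by (auto simp: cayley_edges_on_def)

lemma sym_cayley_edges_on: "sym (cayley_edges_on G S F)"
  by (auto simp: cayley_edges_on_def sym_def)

text \<open>Edges multiply on the left, so a path for \<open>h1\<close> started at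
  \<open>h2 \<otimes> h\<close> continues a path for \<open>h2\<close> started at \<open>h\<close>;
  hence the induction keeps \<open>h\<close> arbitrary. All of \<open>F\<close>, not only the
  endpoint, is joined to \<open>h\<close> inside \<open>F\<close>, a property that survives
  unions.\<close>

lemma (in group) ex_cayley_path:
  assumes "S \<subseteq> carrier G" "g \<in> generate G S" "h \<in> carrier G"
  shows "\<exists>F. finite F \<and> F \<subseteq> carrier G \<and> h \<in> F \<and> g \<otimes> h \<in> F \<and>
           (\<forall>f\<in>F. (h, f) \<in> (cayley_edges_on G S F)\<^sup>*)"
  using assms(2,3)
proof (induction arbitrary: h)
  case one
  then show ?case by (intro exI[of _ "{h}"]) auto
next
  case (incl s)
  then have "s \<in> carrier G" using assms(1) by auto
  then show ?case using incl
    by (intro exI[of _ "{h, s \<otimes> h}"]) (auto simp: cayley_edges_on_def intro!: r_into_rtrancl)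
next
  case (inv s)
  then have "s \<in> carrier G" using assms(1) by auto
  \<comment> \<open>An inverse generator is an edge traversed backwards, which the undirected graph
    permits.\<close>
  then have "h = s \<otimes> (inv s \<otimes> h)" using inv by (simp add: m_assoc[symmetric])
  then show ?case using inv \<open>s \<in> carrier G\<close>
    by (intro exI[of _ "{h, inv s \<otimes> h}"]) (auto simp: cayley_edges_on_def intro!: r_into_rtrancl)
next
  case (eng h1 h2)
  have c: "h1 \<in> carrier G" "h2 \<in> carrier G"
    using eng.hyps generate_in_carrier[OF assms(1)] by auto
  obtain F2 where F2: "finite F2" "F2 \<subseteq> carrier G" "h \<in> F2" "h2 \<otimes> h \<in> F2"
      "\<And>f. f \<in> F2 \<Longrightarrow> (h, f) \<in> (cayley_edges_on G S F2)\<^sup>*"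
    using eng.IH(2)[OF eng.prems] by blast
  obtain F1 where F1: "finite F1" "F1 \<subseteq> carrier G" "h1 \<otimes> (h2 \<otimes> h) \<in> F1"
      "\<And>f. f \<in> F1 \<Longrightarrow> (h2 \<otimes> h, f) \<in> (cayley_edges_on G S F1)\<^sup>*"
    using eng.IH(1)[of "h2 \<otimes> h"] c eng.prems by blast
  let ?E = "(cayley_edges_on G S (F1 \<union> F2))\<^sup>*"
  have E2: "(h, f) \<in> ?E" if "f \<in> F2" for f
    using F2(5)[OF that] rtrancl_mono[OF cayley_edges_on_mono[of F2 "F1 \<union> F2"]] by blast
  have E1: "(h2 \<otimes> h, f) \<in> ?E" if "f \<in> F1" for f
    using F1(4)[OF that] rtrancl_mono[OF cayley_edges_on_mono[of F1 "F1 \<union> F2"]] by blast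
  have "(h, f) \<in> ?E" if "f \<in> F1 \<union> F2" for f
    using that E2[OF F2(4)] E1[of f] E2[of f] by (auto intro: rtrancl_trans)
  moreover have "h1 \<otimes> h2 \<otimes> h \<in> F1 \<union> F2"
    using F1(3) c eng.prems by (simp add: m_assoc)
  ultimately show ?case
    using F1(1,2) F2(1-3) by (intro exI[of _ "F1 \<union> F2"]) blast
qed

text \<open>Take the union of paths from the identity to the points of \<open>A\<close>: any two
  vertices are then joined through the identity.\<close>

lemma (in group) ex_S_connected_superset:
  assumes "S \<subseteq> carrier G" "generate G S = carrier G" "finite A" "A \<subseteq> carrier G"
  obtains F where "finite F" "F \<subseteq> carrier G" "A \<subseteq> F" "\<one> \<in> F" "S_connected G S F"
proof -
  have "\<forall>a\<in>carrier G. \<exists>F. finite F \<and> F \<subseteq> carrier G \<and> \<one> \<in> F \<and> a \<in> F \<and>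
          (\<forall>f\<in>F. (\<one>, f) \<in> (cayley_edges_on G S F)\<^sup>*)"
    using ex_cayley_path[OF assms(1) _ one_closed] assms(2) by (metis r_one)
  then obtain P where P: "\<And>a. a \<in> carrier G \<Longrightarrow> finite (P a)" "\<And>a. a \<in> carrier G \<Longrightarrow> P a \<subseteq> carrier G"
      "\<And>a. a \<in> carrier G \<Longrightarrow> \<one> \<in> P a" "\<And>a. a \<in> carrier G \<Longrightarrow> a \<in> P a"
      "\<And>a f. a \<in> carrier G \<Longrightarrow> f \<in> P a \<Longrightarrow> (\<one>, f) \<in> (cayley_edges_on G S (P a))\<^sup>*"
    by metis
  \<comment> \<open>Inserting the identity puts it into \<open>F\<close> even if \<open>A\<close> is
    empty.\<close>
  define F where "F = (\<Union>a\<in>insert \<one> A. P a)"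
  have one: "(\<one>, f) \<in> (cayley_edges_on G S F)\<^sup>*" if f: "f \<in> F" for f
  proof -
    obtain a where a: "a \<in> insert \<one> A" "f \<in> P a" using f by (auto simp: F_def)
    then have "(\<one>, f) \<in> (cayley_edges_on G S (P a))\<^sup>*" using P(5) assms(4) by auto
    moreover have "P a \<subseteq> F" using a by (auto simp: F_def)
    ultimately show ?thesis using rtrancl_mono[OF cayley_edges_on_mono] by blast
  qed
  have "(g, h) \<in> (cayley_edges_on G S F)\<^sup>*" if "g \<in> F" "h \<in> F" for g h
    using one[OF that(1)] one[OF that(2)] sym_rtrancl[OF sym_cayley_edges_on, of G S F]
    by (meson rtrancl_trans symD)
  then have "S_connected G S F" by (auto simp: S_connected_def)
  moreover have "finite F" using P(1) assms(3,4) by (auto simp: F_def)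
  moreover have "F \<subseteq> carrier G" using P(2) assms(4) unfolding F_def by blast
  moreover have "A \<subseteq> F" using P(4) assms(4) unfolding F_def by blast
  moreover have "\<one> \<in> F" using P(3)[OF one_closed] by (simp add: F_def)
  ultimately show thesis using that by blast
qed

section \<open>Measure-preserving systems, names and cylinder sets\<close>

locale gsystem =
  fixes G :: "('g, 'b) monoid_scheme" (structure) and M :: "'a measure" and T :: "'g \<Rightarrow> 'a \<Rightarrow> 'a"
  assumes sys: "G_system G M T"

sublocale gsystem \<subseteq> group G
  using sys by (simp add: G_system_def)

sublocale gsystem \<subseteq> prob_space M
  using sys by (simp add: G_system_def)

text \<open>The \<open>\<xi>\<^sup>F\<close>-name of \<open>x\<close> is the family of atoms of \<open>\<xi>\<close> containing \<open>g\<^sup>-\<^sup>1x\<close>, for \<open>g \<in> F\<close>;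
  a function that depends only on this name is constant on the atoms of \<open>\<xi>\<^sup>F\<close>.\<close>

definition name_determined ::
  "('g, 'b) monoid_scheme \<Rightarrow> 'a measure \<Rightarrow> ('g \<Rightarrow> 'a \<Rightarrow> 'a) \<Rightarrow> 'a set set \<Rightarrow> 'g set \<Rightarrow> ('a \<Rightarrow> 'c) \<Rightarrow> bool" where
  "name_determined G M T \<xi> F f \<longleftrightarrow> (\<forall>x\<in>space M. \<forall>y\<in>space M.
     (\<forall>g\<in>F. atom \<xi> (T (inv\<^bsub>G\<^esub> g) x) = atom \<xi> (T (inv\<^bsub>G\<^esub> g) y)) \<longrightarrow> f x = f y)"

lemma name_determinedD:
  assumes "name_determined G M T \<xi> F f" "x \<in> space M" "y \<in> space M"
    and "\<And>g. g \<in> F \<Longrightarrow> atom \<xi> (T (inv\<^bsub>G\<^esub> g) x) = atom \<xi> (T (inv\<^bsub>G\<^esub> g) y)"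
  shows "f x = f y"
  using assms unfolding name_determined_def by blast

lemma name_determined_comp:
  assumes "name_determined G M T \<xi> F f" "name_determined G M T \<xi> F' h"
  shows "name_determined G M T \<xi> (F \<union> F') (\<lambda>x. k (f x) (h x))"
  unfolding name_determined_def
proof (intro ballI impI)
  fix x y assume x: "x \<in> space M" "y \<in> space M"
    and eq: "\<forall>g\<in>F \<union> F'. atom \<xi> (T (inv\<^bsub>G\<^esub> g) x) = atom \<xi> (T (inv\<^bsub>G\<^esub> g) y)"
  have "f x = f y" by (rule name_determinedD[OF assms(1) x]) (use eq in blast)
  moreover have "h x = h y" by (rule name_determinedD[OF assms(2) x]) (use eq in blast)
  ultimately show "k (f x) (h x) = k (f y) (h y)" by simp
qed

text \<open>The algebra of measurable sets decided by finitely many coordinates of the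
  \<open>\<xi>\<close>-name.\<close>

definition cylinders ::
  "('g, 'b) monoid_scheme \<Rightarrow> 'a measure \<Rightarrow> ('g \<Rightarrow> 'a \<Rightarrow> 'a) \<Rightarrow> 'a set set \<Rightarrow> 'a set set" where
  "cylinders G M T \<xi> = {A \<in> sets M. \<exists>F. finite F \<and> F \<subseteq> carrier G \<and> name_determined G M T \<xi> F (\<lambda>x. x \<in> A)}"

context gsystem
begin

lemma measurable_T: "g \<in> carrier G \<Longrightarrow> T g \<in> measurable M M"
  using sys by (auto simp: G_system_def)

lemma T_space: "g \<in> carrier G \<Longrightarrow> x \<in> space M \<Longrightarrow> T g x \<in> space M"
  using measurable_space[OF measurable_T] by auto

lemma T_one: "x \<in> space M \<Longrightarrow> T \<one> x = x"
  using sys by (auto simp: G_system_def)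

lemma T_mult: "g \<in> carrier G \<Longrightarrow> h \<in> carrier G \<Longrightarrow> x \<in> space M \<Longrightarrow> T (g \<otimes> h) x = T g (T h x)"
  using sys by (auto simp: G_system_def)

lemma T_inv_mult:
  "g \<in> carrier G \<Longrightarrow> h \<in> carrier G \<Longrightarrow> x \<in> space M \<Longrightarrow> T (inv (g \<otimes> h)) x = T (inv h) (T (inv g) x)"
  by (simp add: inv_mult_group T_mult)

lemma measure_vimage_T:
  assumes "g \<in> carrier G" "A \<in> sets M"
  shows "measure M (T g -` A \<inter> space M) = measure M A"
proof -
  have "distr M M (T g) = M" using sys assms by (auto simp: G_system_def)
  then show ?thesis using measure_distr[OF measurable_T[OF assms(1)] assms(2)] by simp
qed

lemma act_set_sets: "g \<in> carrier G \<Longrightarrow> A \<in> sets M \<Longrightarrow> act_set G M T g A \<in> sets M"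
  unfolding act_set_def by (intro measurable_sets[OF measurable_T]) auto

lemma sym_diff_act_set:
  "sym_diff (act_set G M T g A) (act_set G M T g B) = act_set G M T g (sym_diff A B)"
  by (auto simp: act_set_def)

text \<open>Translation by \<open>g\<close> moves the window from \<open>F\<close> to
  \<open>gF\<close>, because the coordinate \<open>g \<otimes> h\<close> of \<open>x\<close> is the
  coordinate \<open>h\<close> of \<open>T (inv g) x\<close>.\<close>

lemma act_set_cylinder:
  assumes "g \<in> carrier G" "A \<in> cylinders G M T \<xi>"
  shows "act_set G M T g A \<in> cylinders G M T \<xi>"
proof -
  obtain F where F: "finite F" "F \<subseteq> carrier G" "name_determined G M T \<xi> F (\<lambda>x. x \<in> A)" and A: "A \<in> sets M"
    using assms(2) by (auto simp: cylinders_def)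
  have "name_determined G M T \<xi> ((\<otimes>) g ` F) (\<lambda>x. x \<in> act_set G M T g A)"
    unfolding name_determined_def
  proof (intro ballI impI)
    fix x y assume x: "x \<in> space M" and y: "y \<in> space M"
      and eq: "\<forall>h\<in>(\<otimes>) g ` F. atom \<xi> (T (inv h) x) = atom \<xi> (T (inv h) y)"
    have "atom \<xi> (T (inv h) (T (inv g) x)) = atom \<xi> (T (inv h) (T (inv g) y))" if "h \<in> F" for h
      using eq that F(2) assms(1) x y by (auto simp: T_inv_mult subset_iff)
    then have "(T (inv g) x \<in> A) = (T (inv g) y \<in> A)"
      using assms(1) x y by (intro name_determinedD[OF F(3)] T_space) auto
    then show "(x \<in> act_set G M T g A) = (y \<in> act_set G M T g A)"
      using x y by (simp add: act_set_def)
  qed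
  moreover have "(\<otimes>) g ` F \<subseteq> carrier G" using assms(1) F(2) by auto
  ultimately show ?thesis
    using F(1) act_set_sets[OF assms(1) A] unfolding cylinders_def
    by (intro CollectI conjI exI[of _ "(\<otimes>) g ` F"]) auto
qed

lemma cylinder_Compl:
  assumes "A \<in> cylinders G M T \<xi>"
  shows "space M - A \<in> cylinders G M T \<xi>"
proof -
  obtain F where F: "finite F" "F \<subseteq> carrier G" "name_determined G M T \<xi> F (\<lambda>x. x \<in> A)" "A \<in> sets M"
    using assms by (auto simp: cylinders_def)
  have "name_determined G M T \<xi> F (\<lambda>x. x \<in> space M - A)"
    unfolding name_determined_def
  proof (intro ballI impI)
    fix x y assume xy: "x \<in> space M" "y \<in> space M"
      and eq: "\<forall>g\<in>F. atom \<xi> (T (inv g) x) = atom \<xi> (T (inv g) y)"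
    have "(x \<in> A) = (y \<in> A)" by (rule name_determinedD[OF F(3) xy]) (use eq in blast)
    then show "(x \<in> space M - A) = (y \<in> space M - A)" using xy by simp
  qed
  then show ?thesis
    using F(1,2,4) unfolding cylinders_def by blast
qed

lemma cylinder_empty: "{} \<in> cylinders G M T \<xi>"
  unfolding cylinders_def by (intro CollectI conjI exI[of _ "{}"]) (auto simp: name_determined_def)

lemma cylinder_Un:
  assumes "A \<in> cylinders G M T \<xi>" "B \<in> cylinders G M T \<xi>"
  shows "A \<union> B \<in> cylinders G M T \<xi>"
proof -
  obtain F where F: "finite F" "F \<subseteq> carrier G" "name_determined G M T \<xi> F (\<lambda>x. x \<in> A)"
    using assms(1) by (auto simp: cylinders_def)
  obtain F' where F': "finite F'" "F' \<subseteq> carrier G" "name_determined G M T \<xi> F' (\<lambda>x. x \<in> B)"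
    using assms(2) by (auto simp: cylinders_def)
  have "name_determined G M T \<xi> (F \<union> F') (\<lambda>x. x \<in> A \<union> B)"
    using name_determined_comp[OF F(3) F'(3), of "(\<or>)"] by simp
  then show ?thesis
    using F(1,2) F'(1,2) assms unfolding cylinders_def
    by (intro CollectI conjI exI[of _ "F \<union> F'"]) auto
qed

lemma cylinder_UN:
  assumes "finite I" "\<And>i. i \<in> I \<Longrightarrow> A i \<in> cylinders G M T \<xi>"
  shows "(\<Union>i\<in>I. A i) \<in> cylinders G M T \<xi>"
  using assms by (induction I) (auto intro: cylinder_empty cylinder_Un)

lemma cylinder_atom:
  assumes "mpart M \<xi>" "A \<in> \<xi>"
  shows "A \<in> cylinders G M T \<xi>"
proof -
  have "name_determined G M T \<xi> {\<one>} (\<lambda>x. x \<in> A)"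
    unfolding name_determined_def
  proof (intro ballI impI)
    fix x y assume xy: "x \<in> space M" "y \<in> space M"
      and "\<forall>g\<in>{\<one>}. atom \<xi> (T (inv g) x) = atom \<xi> (T (inv g) y)"
    then have "atom \<xi> x = atom \<xi> y" by (simp add: T_one)
    then show "(x \<in> A) = (y \<in> A)"
      using atom_eq_iff[OF assms xy(1)] atom_eq_iff[OF assms xy(2)] by simp
  qed
  then show ?thesis
    using mpart_sets[OF assms] unfolding cylinders_def
    by (intro CollectI conjI exI[of _ "{\<one>}"]) auto
qed

end

section \<open>Approximation by cylinder sets\<close>

text \<open>The closure of the algebra of cylinders under the pseudometric given by the measure of
  the symmetric difference.\<close>

definition approximable ::
  "('g, 'b) monoid_scheme \<Rightarrow> 'a measure \<Rightarrow> ('g \<Rightarrow> 'a \<Rightarrow> 'a) \<Rightarrow> 'a set set \<Rightarrow> 'a set set" where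
  "approximable G M T \<xi> =
     {A \<in> sets M. \<forall>e>0. \<exists>B\<in>cylinders G M T \<xi>. measure M (sym_diff A B) < e}"

context gsystem
begin

lemma cylinder_sets: "A \<in> cylinders G M T \<xi> \<Longrightarrow> A \<in> sets M"
  by (simp add: cylinders_def)

lemma cylinder_approximable: "A \<in> cylinders G M T \<xi> \<Longrightarrow> A \<in> approximable G M T \<xi>"
  using cylinder_sets by (force simp: approximable_def)

text \<open>Continuity from below replaces the union by its first \<open>n\<close> sets at cost
  \<open>e / 2\<close>; approximating these separately costs another \<open>e / 2\<close>, and a
  finite union of cylinders is a cylinder.\<close>

lemma approximable_UN:
  fixes A :: "nat \<Rightarrow> 'a set"
  assumes A: "\<And>i. A i \<in> approximable G M T \<xi>"
  shows "(\<Union>i. A i) \<in> approximable G M T \<xi>"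
proof -
  have sA: "A i \<in> sets M" for i
    using A by (simp add: approximable_def)
  have "\<exists>B\<in>cylinders G M T \<xi>. measure M (sym_diff (\<Union>i. A i) B) < e" if e: "0 < e" for e
  proof -
    define U where "U = (\<lambda>n. \<Union>i<n. A i)"
    have sU: "U n \<in> sets M" for n
      using sA by (auto simp: U_def)
    have "(\<lambda>n. measure M (U n)) \<longlonglongrightarrow> measure M (\<Union>n. U n)"
      by (rule finite_Lim_measure_incseq) (use sU in \<open>auto simp: U_def incseq_def intro: less_le_trans\<close>)
    also have "(\<Union>n. U n) = (\<Union>i. A i)"
      unfolding U_def by blast
    finally have "\<forall>\<^sub>F n in sequentially. measure M (\<Union>i. A i) - e / 2 < measure M (U n)"
      by (rule order_tendstoD) (use e in simp)
    then obtain n where n: "measure M (\<Union>i. A i) - e / 2 < measure M (U n)"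
      by (auto simp: eventually_sequentially)
    define d where "d = e / (2 * (real n + 1))"
    have "0 < d" using e by (simp add: d_def)
    then have "\<forall>i. \<exists>B\<in>cylinders G M T \<xi>. measure M (sym_diff (A i) B) < d"
      using A by (simp add: approximable_def)
    then obtain B where B: "\<And>i. B i \<in> cylinders G M T \<xi>" "\<And>i. measure M (sym_diff (A i) (B i)) < d"
      by metis
    have sB: "B i \<in> sets M" for i
      using cylinder_sets[OF B(1)] .
    have "sym_diff (\<Union>i. A i) (\<Union>i<n. B i) \<subseteq> ((\<Union>i. A i) - U n) \<union> (\<Union>i<n. sym_diff (A i) (B i))"
      unfolding U_def by blast
    then have "measure M (sym_diff (\<Union>i. A i) (\<Union>i<n. B i))
        \<le> measure M (((\<Union>i. A i) - U n) \<union> (\<Union>i<n. sym_diff (A i) (B i)))"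
      using sA sB sU by (intro finite_measure_mono) auto
    also have "\<dots> \<le> measure M ((\<Union>i. A i) - U n) + measure M (\<Union>i<n. sym_diff (A i) (B i))"
      using sA sB sU by (intro measure_Un_le) auto
    also have "measure M ((\<Union>i. A i) - U n) < e / 2"
    proof -
      have "measure M ((\<Union>i. A i) - U n) = measure M (\<Union>i. A i) - measure M (U n)"
        using sA sU by (intro finite_measure_Diff) (auto simp: U_def)
      then show ?thesis using n by simp
    qed
    also have "measure M (\<Union>i<n. sym_diff (A i) (B i)) \<le> (\<Sum>i<n. measure M (sym_diff (A i) (B i)))"
      using sA sB by (intro finite_measure_subadditive_finite) auto
    also have "\<dots> \<le> (\<Sum>i<n. d)"
      using B(2) by (intro sum_mono) (simp add: less_imp_le)
    also have "\<dots> \<le> e / 2"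
    proof -
      have "real n * d \<le> (real n + 1) * d" using \<open>0 < d\<close> by simp
      also have "\<dots> = e / 2" by (simp add: d_def field_simps)
      finally show ?thesis by simp
    qed
    finally have "measure M (sym_diff (\<Union>i. A i) (\<Union>i<n. B i)) < e" by simp
    moreover have "(\<Union>i<n. B i) \<in> cylinders G M T \<xi>"
      using B(1) by (intro cylinder_UN) auto
    ultimately show ?thesis by blast
  qed
  then show ?thesis
    using sA by (auto simp: approximable_def)
qed

lemma sigma_algebra_approximable: "sigma_algebra (space M) (approximable G M T \<xi>)"
  unfolding sigma_algebra_iff2
proof (intro conjI ballI allI impI)
  show "approximable G M T \<xi> \<subseteq> Pow (space M)"
    using sets.sets_into_space by (auto simp: approximable_def)
  show "{} \<in> approximable G M T \<xi>"
    by (intro cylinder_approximable cylinder_empty)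
  fix A assume A: "A \<in> approximable G M T \<xi>"
  have "\<exists>B\<in>cylinders G M T \<xi>. measure M (sym_diff (space M - A) B) < e" if "0 < e" for e
  proof -
    obtain B where B: "B \<in> cylinders G M T \<xi>" "measure M (sym_diff A B) < e"
      using A \<open>0 < e\<close> unfolding approximable_def by blast
    have "sym_diff (space M - A) (space M - B) = sym_diff A B"
      using A B sets.sets_into_space cylinder_sets[OF B(1)] unfolding approximable_def by blast
    then show ?thesis
      using cylinder_Compl[OF B(1)] B(2) by (intro bexI[of _ "space M - B"]) auto
  qed
  then show "space M - A \<in> approximable G M T \<xi>"
    using A by (auto simp: approximable_def)
next
  fix A :: "nat \<Rightarrow> 'a set"
  assume "range A \<subseteq> approximable G M T \<xi>"
  then show "(\<Union>i. A i) \<in> approximable G M T \<xi>"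
    by (intro approximable_UN) blast
qed

lemma act_set_approximable:
  assumes g: "g \<in> carrier G" and A: "A \<in> approximable G M T \<xi>"
  shows "act_set G M T g A \<in> approximable G M T \<xi>"
proof -
  have "\<exists>B\<in>cylinders G M T \<xi>. measure M (sym_diff (act_set G M T g A) B) < e" if "0 < e" for e
  proof -
    obtain B where B: "B \<in> cylinders G M T \<xi>" "measure M (sym_diff A B) < e"
      using A \<open>0 < e\<close> unfolding approximable_def by blast
    have "sym_diff A B \<in> sets M"
      using A cylinder_sets[OF B(1)] by (auto simp: approximable_def)
    then have "measure M (sym_diff (act_set G M T g A) (act_set G M T g B)) < e"
      unfolding sym_diff_act_set unfolding act_set_def
      using B(2) by (subst measure_vimage_T[OF inv_closed[OF g]])
    then show ?thesis
      using act_set_cylinder[OF g B(1)] by blast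
  qed
  then show ?thesis
    using A act_set_sets[OF g] by (auto simp: approximable_def)
qed

text \<open>The approximable sets form an invariant sigma-algebra containing the atoms, so by
  minimality they contain \<open>inv_sigma\<close>; passing from there to \<open>A\<close> changes
  only a null set.\<close>

lemma generating_imp_approximable:
  assumes P: "mpart M \<xi>" and gen: "generating G M T \<xi>" and A: "A \<in> sets M" and e: "0 < e"
  obtains B where "B \<in> cylinders G M T \<xi>" "measure M (sym_diff A B) < e"
proof -
  obtain C where C: "C \<in> inv_sigma G M T \<xi>" "C \<in> sets M" "measure M (A - C) + measure M (C - A) = 0"
    using gen A unfolding generating_def by blast
  have "inv_sigma G M T \<xi> \<subseteq> approximable G M T \<xi>"
    unfolding inv_sigma_def
    using sigma_algebra_approximable act_set_approximable cylinder_approximable cylinder_atom[OF P]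
    by (intro Inter_lower) auto
  then obtain B where B: "B \<in> cylinders G M T \<xi>" "measure M (sym_diff C B) < e"
    using C(1) e unfolding approximable_def by blast
  have sB: "B \<in> sets M" using cylinder_sets[OF B(1)] .
  have "measure M (sym_diff A B) \<le> measure M ((A - C) \<union> (C - A) \<union> sym_diff C B)"
    using A C(2) sB by (intro finite_measure_mono) auto
  also have "\<dots> \<le> measure M ((A - C) \<union> (C - A)) + measure M (sym_diff C B)"
    using A C(2) sB by (intro measure_Un_le) auto
  also have "measure M ((A - C) \<union> (C - A)) \<le> measure M (A - C) + measure M (C - A)"
    using A C(2) by (intro measure_Un_le) auto
  finally show thesis using that B C(3) by simp
qed

end

text \<open>All atoms outside \<open>K\<close> are merged into the one value \<open>None\<close>, so
  a finite \<open>K\<close> gives a finite alphabet.\<close>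

definition trunc :: "'a set set \<Rightarrow> 'a set \<Rightarrow> 'a set option" where
  "trunc K B = (if B \<in> K then Some B else None)"

text \<open>The measures of the atoms sum to 1, so some finite partial sum exceeds
  \<open>1 - e\<close>.\<close>

lemma (in prob_space) ex_finite_large_subpartition:
  assumes P: "mpart M \<eta>" and e: "0 < e"
  obtains K where "finite K" "K \<subseteq> \<eta>" "measure M {x \<in> space M. atom \<eta> x \<notin> K} < e"
proof -
  have dj: "disjoint_family_on (\<lambda>B. B) \<eta>"
    using P by (simp add: disjoint_family_on_def mpart_def disjoint_def)
  have "((\<lambda>B. measure M B) has_sum measure M (\<Union>B\<in>\<eta>. B)) \<eta>"
    by (rule has_sum_measure_UN) (use P dj in \<open>auto simp: mpart_def\<close>)
  also have "measure M (\<Union>B\<in>\<eta>. B) = 1"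
    using P prob_space by (simp add: mpart_def)
  finally have "(sum (measure M) \<longlongrightarrow> 1) (finite_subsets_at_top \<eta>)"
    by (simp add: has_sum_def)
  then have "\<forall>\<^sub>F K in finite_subsets_at_top \<eta>. 1 - e < sum (measure M) K"
    by (rule order_tendstoD) (use e in simp)
  then obtain K where K: "finite K" "K \<subseteq> \<eta>" "1 - e < sum (measure M) K"
    unfolding eventually_finite_subsets_at_top by blast
  have KM: "K \<subseteq> sets M" using K(2) P by (auto simp: mpart_def)
  have "{x \<in> space M. atom \<eta> x \<notin> K} = space M - \<Union>K"
    using atom_in[OF P] K(2) atom_eq[OF P] by blast
  then have "measure M {x \<in> space M. atom \<eta> x \<notin> K} = 1 - measure M (\<Union>K)"
    using prob_compl[of "\<Union>K"] K(1) KM by (simp add: sets.finite_Union)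
  also have "measure M (\<Union>K) = sum (measure M) K"
    using finite_measure_finite_Union[of K "\<lambda>B. B"] K(1) KM disjoint_family_on_mono[OF K(2) dj] by simp
  finally show thesis using that K by simp
qed

context gsystem
begin

lemma name_determined_finite_family:
  assumes "finite K" "\<And>B. B \<in> K \<Longrightarrow> A B \<in> cylinders G M T \<xi>"
  obtains F where "finite F" "F \<subseteq> carrier G" "name_determined G M T \<xi> F (\<lambda>x. {B \<in> K. x \<in> A B})"
proof -
  have "\<forall>B\<in>K. \<exists>F. finite F \<and> F \<subseteq> carrier G \<and> name_determined G M T \<xi> F (\<lambda>x. x \<in> A B)"
    using assms(2) by (auto simp: cylinders_def)
  then obtain F where F: "\<And>B. B \<in> K \<Longrightarrow> finite (F B)" "\<And>B. B \<in> K \<Longrightarrow> F B \<subseteq> carrier G"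
      "\<And>B. B \<in> K \<Longrightarrow> name_determined G M T \<xi> (F B) (\<lambda>x. x \<in> A B)"
    by metis
  have "name_determined G M T \<xi> (\<Union>B\<in>K. F B) (\<lambda>x. {B \<in> K. x \<in> A B})"
    unfolding name_determined_def
  proof (intro ballI impI)
    fix x y assume xy: "x \<in> space M" "y \<in> space M"
      and eq: "\<forall>g\<in>\<Union> (F ` K). atom \<xi> (T (inv g) x) = atom \<xi> (T (inv g) y)"
    have "(x \<in> A B) = (y \<in> A B)" if "B \<in> K" for B
      by (rule name_determinedD[OF F(3)[OF that] xy]) (use eq that in blast)
    then show "{B \<in> K. x \<in> A B} = {B \<in> K. y \<in> A B}" by blast
  qed
  moreover have "finite (\<Union>B\<in>K. F B)" using F(1) assms(1) by blast
  moreover have "(\<Union>B\<in>K. F B) \<subseteq> carrier G" using F(2) by blast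
  ultimately show thesis using that by blast
qed

text \<open>Every \<open>B\<close> in \<open>K\<close> is replaced by a nearby cylinder
  \<open>A B\<close>, and \<open>b\<close> reads off which of these contain \<open>x\<close>. The
  alphabet of \<open>b\<close> depends on \<open>K\<close> but not on \<open>e\<close>, which later
  allows the accuracy to be chosen after the alphabet.\<close>

lemma approximate_by_names:
  assumes P: "mpart M \<xi>" and gen: "generating G M T \<xi>"
    and P': "mpart M \<eta>" and K: "finite K" "K \<subseteq> \<eta>" and e: "0 < e"
  obtains F b where "finite F" "F \<subseteq> carrier G" "name_determined G M T \<xi> F b"
    "b \<in> measurable M (count_space (insert None (Some ` K)))"
    "measure M {x \<in> space M. b x \<noteq> trunc K (atom \<eta> x)} < e"
proof -
  define d where "d = e / (real (card K) + 1)"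
  have d: "0 < d" using e by (simp add: d_def)
  have "\<forall>B\<in>K. \<exists>A\<in>cylinders G M T \<xi>. measure M (sym_diff B A) < d"
    using generating_imp_approximable[OF P gen _ d] K(2) mpart_sets[OF P'] by (metis subsetD)
  then obtain A where A: "\<And>B. B \<in> K \<Longrightarrow> A B \<in> cylinders G M T \<xi>"
      "\<And>B. B \<in> K \<Longrightarrow> measure M (sym_diff B (A B)) < d"
    by metis
  have sA: "A B \<in> sets M" if "B \<in> K" for B
    using cylinder_sets[OF A(1)[OF that]] .
  have sK: "B \<in> sets M" if "B \<in> K" for B
    using mpart_sets[OF P'] K(2) that by blast
  \<comment> \<open>The approximating cylinders may overlap or miss a point; only an unambiguous
    answer is decoded, anything else becomes \<open>None\<close>.\<close>
  define \<psi> :: "'a set set \<Rightarrow> 'a set option" where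
    "\<psi> = (\<lambda>Z. if \<exists>B. Z = {B} then Some (the_elem Z) else None)"
  define b where "b = (\<lambda>x. \<psi> {B \<in> K. x \<in> A B})"
  obtain F where F: "finite F" "F \<subseteq> carrier G" "name_determined G M T \<xi> F (\<lambda>x. {B \<in> K. x \<in> A B})"
    using name_determined_finite_family[of K A \<xi>] K(1) A(1) by blast
  have "name_determined G M T \<xi> F b"
    using name_determined_comp[OF F(3) F(3), of "\<lambda>Z _. \<psi> Z"] by (simp add: b_def)
  moreover have "b \<in> measurable M (count_space (insert None (Some ` K)))"
    unfolding b_def
  proof (rule measurable_compose[where f = "\<lambda>x. {B \<in> K. x \<in> A B}" and N = "count_space (Pow K)"])
    have "(\<lambda>x. {B \<in> K. x \<in> A B}) -` {Z} \<inter> space M \<in> sets M" if "Z \<subseteq> K" for Z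
    proof -
      have "(\<lambda>x. {B \<in> K. x \<in> A B}) -` {Z} \<inter> space M = {x \<in> space M. \<forall>B\<in>K. x \<in> A B \<longleftrightarrow> B \<in> Z}"
        using that by auto
      also have "\<dots> \<in> sets M"
        using sA by (intro sets.sets_Collect_finite_All sets.sets_Collect K(1)) auto
      finally show ?thesis .
    qed
    then show "(\<lambda>x. {B \<in> K. x \<in> A B}) \<in> measurable M (count_space (Pow K))"
      using K(1) by (subst measurable_count_space_eq2) auto
    show "\<psi> \<in> measurable (count_space (Pow K)) (count_space (insert None (Some ` K)))"
      by (auto simp: \<psi>_def)
  qed
  moreover have "measure M {x \<in> space M. b x \<noteq> trunc K (atom \<eta> x)} < e"
  proof -
    \<comment> \<open>Off the symmetric differences, membership in \<open>A B\<close> agrees with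
      membership in \<open>B\<close>, and the decoded value is the truncated atom.\<close>
    have "{x \<in> space M. b x \<noteq> trunc K (atom \<eta> x)} \<subseteq> (\<Union>B\<in>K. sym_diff B (A B))"
    proof (rule subsetI, rule ccontr)
      fix x assume x: "x \<in> {x \<in> space M. b x \<noteq> trunc K (atom \<eta> x)}"
        and nx: "x \<notin> (\<Union>B\<in>K. sym_diff B (A B))"
      then have "{B \<in> K. x \<in> A B} = {B \<in> K. x \<in> B}" by blast
      also have "\<dots> = {B \<in> K. atom \<eta> x = B}"
        using atom_eq_iff[OF P'] K(2) x by blast
      finally have "b x = \<psi> {B \<in> K. atom \<eta> x = B}" by (simp add: b_def)
      also have "\<dots> = trunc K (atom \<eta> x)"
      proof (cases "atom \<eta> x \<in> K")
        case True
        then have *: "{B \<in> K. atom \<eta> x = B} = {atom \<eta> x}" by blast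
        show ?thesis unfolding * using True by (simp add: \<psi>_def trunc_def)
      next
        case False
        then have *: "{B \<in> K. atom \<eta> x = B} = {}" by blast
        show ?thesis unfolding * using False by (simp add: \<psi>_def trunc_def)
      qed
      finally show False using x by simp
    qed
    then have "measure M {x \<in> space M. b x \<noteq> trunc K (atom \<eta> x)} \<le> measure M (\<Union>B\<in>K. sym_diff B (A B))"
      using sA sK K(1) by (intro finite_measure_mono) auto
    also have "\<dots> \<le> (\<Sum>B\<in>K. measure M (sym_diff B (A B)))"
      using sA sK K(1) by (intro finite_measure_subadditive_finite) auto
    also have "\<dots> \<le> (\<Sum>B\<in>K. d)"
      using A(2) by (intro sum_mono) (simp add: less_imp_le)
    also have "\<dots> < (real (card K) + 1) * d" using d by simp
    also have "\<dots> = e" by (simp add: d_def)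
    finally show ?thesis .
  qed
  ultimately show thesis using that F(1,2) by blast
qed

end

section \<open>Entropy bounds from guessing\<close>

text \<open>Only attained values index the partition, so every atom is non-empty and
  \<open>label\<close> can read its value off a chosen point.\<close>

definition fibres :: "'a measure \<Rightarrow> ('a \<Rightarrow> 'c) \<Rightarrow> 'a set set" where
  "fibres M l = (\<lambda>v. {x \<in> space M. l x = v}) ` l ` space M"

definition label :: "('a \<Rightarrow> 'c) \<Rightarrow> 'a set \<Rightarrow> 'c" where
  "label l C = l (SOME x. x \<in> C)"

lemma mpart_fibres:
  assumes "l \<in> measurable M (count_space L)" "countable L"
  shows "mpart M (fibres M l)"
proof -
  have L: "l ` space M \<subseteq> L"
    using measurable_space[OF assms(1)] by auto
  have "{x \<in> space M. l x = v} \<in> sets M" if "v \<in> L" for v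
  proof -
    have "{x \<in> space M. l x = v} = l -` {v} \<inter> space M" by auto
    then show ?thesis using measurable_sets[OF assms(1), of "{v}"] that by simp
  qed
  moreover have "countable (l ` space M)"
    using countable_subset[OF L assms(2)] .
  ultimately show ?thesis
    using L by (auto simp: mpart_def fibres_def disjoint_def)
qed

lemma atom_fibres:
  assumes "mpart M (fibres M l)" "x \<in> space M"
  shows "atom (fibres M l) x = {y \<in> space M. l y = l x}"
  by (rule atom_eq[OF assms(1)]) (use assms(2) in \<open>auto simp: fibres_def\<close>)

lemma label_fibre:
  assumes "x \<in> space M"
  shows "label l {y \<in> space M. l y = l x} = l x"
proof -
  have "(SOME y. y \<in> {y \<in> space M. l y = l x}) \<in> {y \<in> space M. l y = l x}"
    by (rule someI[of _ x]) (use assms in simp)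
  then show ?thesis by (simp add: label_def)
qed

lemma inj_on_label: "inj_on (label l) (fibres M l)"
  by (rule inj_onI) (auto simp: fibres_def label_fibre)

lemma label_fibres_subset: "label l ` fibres M l \<subseteq> l ` space M"
  by (auto simp: fibres_def label_fibre)

text \<open>The common shape of the kernels below: mass \<open>1 - t\<close> on at most one guess
  \<open>c\<close>, and \<open>t\<close> times a subprobability \<open>u\<close> elsewhere, so that
  no outcome of positive \<open>u\<close>-mass has infinite code length.\<close>

lemma sum_mixture_le_1:
  fixes u :: "'c \<Rightarrow> real"
  assumes "finite Z" "\<And>z. z \<in> Z \<Longrightarrow> 0 \<le> u z" "sum u Z \<le> 1" "0 \<le> t" "t \<le> 1"
    and P: "\<And>z. P z \<Longrightarrow> z = c"
  shows "(\<Sum>z\<in>Z. if P z then 1 - t else t * u z) \<le> 1"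
proof -
  have "(\<Sum>z\<in>Z. if P z then 1 - t else t * u z) \<le> (\<Sum>z\<in>Z. (if z = c then 1 - t else 0) + t * u z)"
    using assms(2,4,5) P by (intro sum_mono) auto
  also have "\<dots> \<le> (1 - t) + t * sum u Z"
    using assms(1,5) by (simp add: sum.distrib sum_distrib_left)
  also have "\<dots> \<le> (1 - t) + t * 1"
    using assms(3,4) by (intro add_left_mono mult_left_mono) auto
  finally show ?thesis by simp
qed

context prob_space
begin

lemma sum_measure_atoms_le_1:
  assumes P: "mpart M \<xi>" and K: "finite K" "K \<subseteq> \<xi>"
  shows "sum (measure M) K \<le> 1"
proof -
  have "disjoint_family_on (\<lambda>B. B) \<xi>"
    using P by (simp add: disjoint_family_on_def mpart_def disjoint_def)
  then have "disjoint_family_on (\<lambda>B. B) K"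
    by (rule disjoint_family_on_mono[OF K(2)])
  moreover have "K \<subseteq> sets M" using P K(2) by (auto simp: mpart_def)
  ultimately have "sum (measure M) K = measure M (\<Union>K)"
    using finite_measure_finite_Union[of K "\<lambda>B. B"] K(1) by simp
  then show ?thesis by simp
qed

lemma integrable_indicator_mult:
  fixes f :: "'a \<Rightarrow> real"
  assumes "D \<in> sets M" "integrable M f"
  shows "integrable M (\<lambda>x. indicator D x * f x)"
  using integrable_mult_indicator[OF assms] by simp

text \<open>A Fano-type inequality: \<open>D\<close> is the set where the guess \<open>w\<close> for the atom of \<open>\<xi>\<close> is wrong.\<close>

lemma cond_entropy_guess:
  assumes X: "fin_ent_part M \<xi>" and Y: "mpart M \<eta>" and t: "0 < t" "t < 1"
    and D: "{x \<in> space M. w (atom \<eta> x) \<noteq> Some (atom \<xi> x)} \<in> sets M" (is "?D \<in> _")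
  shows "cond_entropy M \<xi> \<eta> \<le> - ln (1 - t) + (\<integral>x. indicator ?D x * (- ln t + info M \<xi> x) \<partial>M)"
proof -
  note P = fin_ent_part_mpart[OF X]
  \<comment> \<open>Here \<open>B\<close> stands for an atom of \<open>\<xi>\<close> and
    \<open>C\<close> for an atom of \<open>\<eta>\<close>. A correct guess costs
    \<open>- ln (1 - t)\<close>, a wrong one \<open>- ln t\<close> plus the information of the atom
    of \<open>\<xi>\<close>.\<close>
  define q where "q = (\<lambda>B C. if w C = Some B then 1 - t else t * measure M B)"
  define Q where "Q = (\<lambda>x. - ln (1 - t) + indicator ?D x * (- ln t + info M \<xi> x))"
  have int: "integrable M (\<lambda>x. indicator ?D x * (- ln t + info M \<xi> x))"
    using D integrable_info[OF X] by (intro integrable_indicator_mult) auto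
  have lnt: "0 \<le> - ln (1 - t)" "0 \<le> - ln t" using t by auto
  have "cond_entropy M \<xi> \<eta> \<le> (\<integral>x. Q x \<partial>M)"
  proof (rule gibbs_bound(2)[OF P Y])
    show "0 \<le> q C B" for C B using t by (simp add: q_def)
    \<comment> \<open>If \<open>w B\<close> is \<open>None\<close> there is no guess: the condition
      never holds and \<open>the (w B)\<close> is an arbitrary value.\<close>
    show "(\<Sum>C\<in>K. q C B) \<le> 1" if "finite K" "K \<subseteq> \<xi>" "B \<in> \<eta>" for K B
      unfolding q_def using t that sum_measure_atoms_le_1[OF P that(1,2)]
      by (intro sum_mixture_le_1[where c = "the (w B)"]) auto
    show "integrable M Q" unfolding Q_def using int by simp
    show "0 \<le> Q x" for x
      using lnt info_nonneg[of \<xi> x] by (auto simp: Q_def indicator_def)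
    fix x assume x: "x \<in> space M" and pos: "0 < measure M (atom \<xi> x \<inter> atom \<eta> x)"
    have "measure M (atom \<xi> x \<inter> atom \<eta> x) \<le> measure M (atom \<xi> x)"
      using mpart_sets[OF P atom_in(1)[OF P x]] by (intro finite_measure_mono) auto
    then have "0 < measure M (atom \<xi> x)" using pos by simp
    then show "0 < q (atom \<xi> x) (atom \<eta> x) \<and> - ln (q (atom \<xi> x) (atom \<eta> x)) \<le> Q x"
      using t lnt x by (auto simp: q_def Q_def info_def ln_mult)
  qed
  also have "\<dots> = - ln (1 - t) + (\<integral>x. indicator ?D x * (- ln t + info M \<xi> x) \<partial>M)"
    unfolding Q_def using int by (simp add: prob_space)
  finally show ?thesis .
qed

text \<open>The label is coded by a product kernel. The first coordinate is guessed by
  \<open>f\<close>, with the uniform law on \<open>V\<close> as fallback; the second is guessed to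
  be \<open>None\<close>, with the law of \<open>\<xi>\<close> as fallback. Both guesses cost
  \<open>- ln (1 - t)\<close> when right; the extra costs live on the mismatch set and on
  \<open>E\<close>.\<close>

lemma cond_entropy_fibres:
  assumes X: "fin_ent_part M \<xi>" and Y: "mpart M \<eta>" and t: "0 < t" "t < 1"
    and b: "b \<in> measurable M (count_space V)" and V: "finite V"
    and E: "E \<in> sets M"
    and l: "l = (\<lambda>x. (b x, if x \<in> E then Some (atom \<xi> x) else None))"
    and P': "mpart M (fibres M l)"
    and D: "{x \<in> space M. b x \<noteq> f (atom \<eta> x)} \<in> sets M" (is "?D \<in> _")
  shows "(\<lambda>(C, B). if measure M (C \<inter> B) = 0 then 0
           else - measure M (C \<inter> B) * ln (measure M (C \<inter> B) / measure M B)) summable_on fibres M l \<times> \<eta>"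
    and "cond_entropy M (fibres M l) \<eta> \<le> - 2 * ln (1 - t) + measure M ?D * (ln (card V) - ln t)
           + (\<integral>x. indicator E x * (- ln t + info M \<xi> x) \<partial>M)"
proof -
  note P = fin_ent_part_mpart[OF X]
  define N where "N = real (card V)"
  obtain x0 where x0: "x0 \<in> space M" using not_empty by blast
  have "b x0 \<in> V" using measurable_space[OF b x0] by simp
  then have N: "1 \<le> N" using V unfolding N_def by (metis One_nat_def Suc_leI card_gt_0_iff empty_iff of_nat_1 of_nat_le_iff)
  \<comment> \<open>\<open>None\<close> gets weight 0 because it is the guess and already carries
    mass \<open>1 - t\<close>.\<close>
  define u where "u = (\<lambda>z. case z of None \<Rightarrow> 0 | Some A \<Rightarrow> measure M A)"
  define q1 where "q1 = (\<lambda>v B. if v = f B then 1 - t else t * (1 / N))"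
  define q2 where "q2 = (\<lambda>z. if z = None then 1 - t else t * u z)"
  define q where "q = (\<lambda>C B. q1 (fst (label l C)) B * q2 (snd (label l C)))"
  define Q where "Q = (\<lambda>x. - 2 * ln (1 - t) + indicator ?D x * (ln N - ln t)
    + indicator E x * (- ln t + info M \<xi> x))"
  have q1: "0 \<le> q1 v B" for v B using t N by (simp add: q1_def)
  have q2: "0 \<le> q2 z" for z using t by (auto simp: q2_def u_def split: option.splits)
  have i1: "integrable M (\<lambda>x. indicator ?D x * (ln N - ln t))"
    using D by (intro integrable_indicator_mult) auto
  have i2: "integrable M (\<lambda>x. indicator E x * (- ln t + info M \<xi> x))"
    using E integrable_info[OF X] by (intro integrable_indicator_mult) auto
  have lnt: "0 \<le> - ln (1 - t)" "0 \<le> - ln t" "0 \<le> ln N" using t N by auto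
  have lsub: "l ` space M \<subseteq> V \<times> insert None (Some ` \<xi>)"
    using measurable_space[OF b] atom_in(1)[OF P] by (auto simp: l)
  have q0: "0 \<le> q C B" for C B using q1 q2 by (simp add: q_def)
  have qs: "(\<Sum>C\<in>K. q C B) \<le> 1" if K: "finite K" "K \<subseteq> fibres M l" "B \<in> \<eta>" for K B
  proof -
    \<comment> \<open>Labels are injective on fibres and lie in the rectangle
      \<open>V \<times> Z\<close>, over which the product kernel factorizes.\<close>
    define Z where "Z = snd ` label l ` K"
    have fZ: "finite Z" using K(1) by (simp add: Z_def)
    have lK: "label l ` K \<subseteq> V \<times> insert None (Some ` \<xi>)"
      using label_fibres_subset[of l M] lsub K(2) by blast
    then have Z: "Z \<subseteq> insert None (Some ` \<xi>)"
      unfolding Z_def by (auto simp: mem_Times_iff)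
    have lZ: "label l ` K \<subseteq> V \<times> Z"
    proof
      fix i assume i: "i \<in> label l ` K"
      then have "fst i \<in> V" using lK by (auto simp: mem_Times_iff)
      then show "i \<in> V \<times> Z" using i by (simp add: Z_def mem_Times_iff)
    qed
    have "(\<Sum>C\<in>K. q C B) = (\<Sum>i\<in>label l ` K. q1 (fst i) B * q2 (snd i))"
      using inj_on_subset[OF inj_on_label K(2)] by (simp add: sum.reindex q_def)
    also have "\<dots> \<le> (\<Sum>i\<in>V \<times> Z. q1 (fst i) B * q2 (snd i))"
      using lZ V fZ q1 q2 by (intro sum_mono2) auto
    also have "\<dots> = (\<Sum>v\<in>V. q1 v B) * (\<Sum>z\<in>Z. q2 z)"
      by (simp add: sum_product sum.cartesian_product case_prod_unfold)
    also have "\<dots> \<le> 1 * 1"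
    proof (rule mult_mono)
      show "(\<Sum>v\<in>V. q1 v B) \<le> 1"
        unfolding q1_def using V N t
        by (intro sum_mixture_le_1[where c = "f B"]) (auto simp: N_def)
      have "sum u Z = sum u (Z - {None})"
        using fZ by (intro sum.mono_neutral_right) (auto simp: u_def)
      also have "\<dots> = (\<Sum>A\<in>the ` (Z - {None}). measure M A)"
        by (subst sum.reindex) (auto simp: inj_on_def u_def split: option.splits intro!: sum.cong)
      also have "\<dots> \<le> 1"
        using Z fZ by (intro sum_measure_atoms_le_1[OF P]) auto
      finally show "(\<Sum>z\<in>Z. q2 z) \<le> 1"
        unfolding q2_def using fZ t
        by (intro sum_mixture_le_1[where c = None]) (auto simp: u_def split: option.splits)
    qed (use q1 q2 in \<open>auto intro: sum_nonneg\<close>)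
    finally show ?thesis by simp
  qed
  have Qint: "integrable M Q" unfolding Q_def using i1 i2 by simp
  have Q0: "0 \<le> Q x" for x
    using lnt info_nonneg[of \<xi> x] by (auto simp: Q_def indicator_def)
  have qQ: "0 < q (atom (fibres M l) x) (atom \<eta> x) \<and> - ln (q (atom (fibres M l) x) (atom \<eta> x)) \<le> Q x"
    if x: "x \<in> space M" and pos: "0 < measure M (atom (fibres M l) x \<inter> atom \<eta> x)" for x
  proof -
    have lab: "label l (atom (fibres M l) x) = l x"
      by (simp add: atom_fibres[OF P' x] label_fibre[OF x])
    have 1: "0 < q1 (b x) (atom \<eta> x)" "- ln (q1 (b x) (atom \<eta> x)) \<le> - ln (1 - t) + indicator ?D x * (ln N - ln t)"
      using t N lnt x by (auto simp: q1_def ln_div)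
    have 2: "0 < q2 (snd (l x)) \<and> - ln (q2 (snd (l x))) \<le> - ln (1 - t) + indicator E x * (- ln t + info M \<xi> x)"
    proof (cases "x \<in> E")
      case True
      \<comment> \<open>On \<open>E\<close> the label records the atom of \<open>\<xi>\<close>, so a
        cell of positive measure forces that atom to have positive measure and the fallback to be
        positive.\<close>
      have "atom (fibres M l) x \<inter> atom \<eta> x \<subseteq> atom \<xi> x"
        unfolding atom_fibres[OF P' x] using True atom_in(2)[OF P] by (auto simp: l split: if_splits)
      then have "measure M (atom (fibres M l) x \<inter> atom \<eta> x) \<le> measure M (atom \<xi> x)"
        using mpart_sets[OF P atom_in(1)[OF P x]] by (intro finite_measure_mono) auto
      then have "0 < measure M (atom \<xi> x)" using pos by simp
      then show ?thesis
        using True t lnt by (simp add: l q2_def u_def info_def ln_mult)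
    next
      case False
      then show ?thesis using t by (simp add: l q2_def)
    qed
    have "q (atom (fibres M l) x) (atom \<eta> x) = q1 (b x) (atom \<eta> x) * q2 (snd (l x))"
      by (simp add: q_def lab) (simp add: l)
    then show ?thesis
      using 1 2 by (simp add: ln_mult Q_def)
  qed
  note G = gibbs_bound[OF P' Y q0 qs Qint Q0 qQ]
  show "(\<lambda>(C, B). if measure M (C \<inter> B) = 0 then 0
           else - measure M (C \<inter> B) * ln (measure M (C \<inter> B) / measure M B)) summable_on fibres M l \<times> \<eta>"
    by (rule G(1))
  have "cond_entropy M (fibres M l) \<eta> \<le> (\<integral>x. Q x \<partial>M)" by (rule G(2))
  also have "\<dots> = - 2 * ln (1 - t) + measure M ?D * (ln N - ln t)
           + (\<integral>x. indicator E x * (- ln t + info M \<xi> x) \<partial>M)"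
    unfolding Q_def using i1 i2 D by (simp add: prob_space Int_absorb2[OF sets.sets_into_space])
  finally show "cond_entropy M (fibres M l) \<eta> \<le> - 2 * ln (1 - t) + measure M ?D * (ln (card V) - ln t)
           + (\<integral>x. indicator E x * (- ln t + info M \<xi> x) \<partial>M)"
    by (simp add: N_def)
qed

text \<open>Conditioning on the trivial partition gives back the unconditional entropy
  terms.\<close>

lemma summable_entropy_of_cond:
  assumes "(\<lambda>(C, B). if measure M (C \<inter> B) = 0 then 0
           else - measure M (C \<inter> B) * ln (measure M (C \<inter> B) / measure M B)) summable_on \<xi> \<times> {space M}"
    and "mpart M \<xi>"
  shows "(\<lambda>C. ent_term (measure M C)) summable_on \<xi>"
proof -
  have inj: "inj_on (\<lambda>C. (C, space M)) \<xi>" by (auto simp: inj_on_def)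
  have "\<xi> \<times> {space M} = (\<lambda>C. (C, space M)) ` \<xi>" by auto
  then have "(\<lambda>C. if measure M (C \<inter> space M) = 0 then 0
           else - measure M (C \<inter> space M) * ln (measure M (C \<inter> space M) / measure M (space M))) summable_on \<xi>"
    using assms(1) summable_on_reindex[OF inj, THEN iffD1] by (fastforce simp: o_def)
  moreover have "C \<inter> space M = C" if "C \<in> \<xi>" for C
    using sets.sets_into_space[OF mpart_sets[OF assms(2) that]] by auto
  ultimately show ?thesis
    by (subst summable_on_cong) (auto simp: ent_term_def prob_space)
qed

end

text \<open>Two points of one set of the join have the same \<open>\<eta>\<close>-name over
  \<open>F\<close>, hence lie in the same atom of \<open>\<xi>\<close>.\<close>

lemma (in gsystem) part_le_join_over:
  assumes X: "mpart M \<xi>" and Y: "mpart M \<eta>" and F: "F \<subseteq> carrier G"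
    and det: "name_determined G M T \<eta> F (atom \<xi>)"
  shows "part_le M \<xi> (join_over G M T F \<eta>)"
  unfolding part_le_def
proof
  fix Z assume "Z \<in> join_over G M T F \<eta>"
  then obtain c where Z: "Z = space M \<inter> (\<Inter>g\<in>F. c g)" and c: "\<And>g. g \<in> F \<Longrightarrow> c g \<in> act_part G M T g \<eta>"
    by (auto simp: join_over_def)
  \<comment> \<open>The join as defined may contain the empty set; then any point of the space
    serves.\<close>
  obtain x where x: "x \<in> space M" "Z = {} \<or> x \<in> Z"
    using not_empty Z by blast
  have "Z \<subseteq> atom \<xi> x"
  proof
    fix y assume y: "y \<in> Z"
    then have xZ: "x \<in> Z" and yM: "y \<in> space M" using x Z by auto
    have "atom \<xi> x = atom \<xi> y"
    proof (rule name_determinedD[OF det x(1) yM])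
      fix g assume g: "g \<in> F"
      then obtain B where "B \<in> \<eta>" "c g = act_set G M T g B"
        using c[OF g] by (auto simp: act_part_def)
      moreover have "x \<in> c g" "y \<in> c g" using xZ y Z g by auto
      ultimately show "atom \<eta> (T (inv g) x) = atom \<eta> (T (inv g) y)"
        using atom_eq[OF Y] by (auto simp: act_set_def)
    qed
    then show "y \<in> atom \<xi> x" using atom_in(2)[OF X yM] by simp
  qed
  then have "measure M (Z - atom \<xi> x) = 0"
    by (metis Diff_eq_empty_iff measure_empty)
  then show "\<exists>B\<in>\<xi>. measure M (Z - B) = 0"
    using atom_in(1)[OF X x(1)] by blast
qed

section \<open>Density\<close>

text \<open>Both maps take countably many values, so any relation \<open>R\<close> between them
  defines a countable union of measurable sets.\<close>

lemma sets_Collect_label_atom: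
  assumes b: "b \<in> measurable M (count_space V)" and V: "countable V" and P: "mpart M \<eta>"
  shows "{x \<in> space M. R (b x) (atom \<eta> x)} \<in> sets M"
proof -
  have "{x \<in> space M. R (b x) (atom \<eta> x)}
      = (\<Union>v\<in>V. (b -` {v} \<inter> space M) \<inter> (atom \<eta> -` {B \<in> \<eta>. R v B} \<inter> space M))"
    using measurable_space[OF b] atom_in(1)[OF P] by auto
  also have "\<dots> \<in> sets M"
  proof (rule sets.countable_UN''[OF V])
    show "(b -` {v} \<inter> space M) \<inter> (atom \<eta> -` {B \<in> \<eta>. R v B} \<inter> space M) \<in> sets M" if "v \<in> V" for v
      by (intro sets.Int measurable_sets[OF b] measurable_sets[OF measurable_atom[OF P]]) (use that in auto)
  qed
  finally show ?thesis .
qed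

lemma (in gsystem) S_equivalent_dense:
  assumes S: "S \<subseteq> carrier G" "generate G S = carrier G"
    and A: "fin_ent_part M \<alpha>" and B: "fin_ent_part M \<beta>"
    and genA: "generating G M T \<alpha>" and genB: "generating G M T \<beta>"
    and e: "0 < (\<epsilon>::real)"
  shows "\<exists>\<alpha>'. fin_ent_part M \<alpha>' \<and> S_equivalent G M T S \<alpha>' \<alpha> \<and> rohlin_dist M \<alpha>' \<beta> < \<epsilon>"
proof -

  \<comment> \<open>Choice of constants and approximations\<close>
  note PA = fin_ent_part_mpart[OF A] and PB = fin_ent_part_mpart[OF B]
  \<comment> \<open>Chosen so that a correct guess costs \<open>\<epsilon> / 16\<close>. The budget
    is at most \<open>3 * \<epsilon> / 8\<close> for \<open>\<alpha>'\<close> given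
    \<open>\<beta>\<close> and \<open>3 * \<epsilon> / 16\<close> for \<open>\<beta>\<close> given
    \<open>\<alpha>'\<close>.\<close>
  define t where "t = 1 - exp (- \<epsilon> / 16)"
  have t: "0 < t" "t < 1" and lnt: "ln (1 - t) = - \<epsilon> / 16" using e by (auto simp: t_def)
  have lnt0: "0 \<le> - ln t" using t by simp
  have small: "\<exists>d>0. \<forall>D\<in>sets M. measure M D < d \<longrightarrow>
      (\<integral>x. indicator D x * (- ln t + info M \<xi> x) \<partial>M) < \<epsilon> / 8" if "fin_ent_part M \<xi>" for \<xi>
  proof -
    have "integrable M (\<lambda>x. - ln t + info M \<xi> x)" using integrable_info[OF that] by simp
    moreover have "0 \<le> - ln t + info M \<xi> x" for x
      using lnt0 info_nonneg[of \<xi> x] by (rule add_nonneg_nonneg)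
    moreover have "0 < \<epsilon> / 8" using e by simp
    ultimately show ?thesis by (rule set_integral_small) blast
  qed
  obtain dB where dB: "0 < dB" "\<And>D. D \<in> sets M \<Longrightarrow> measure M D < dB \<Longrightarrow>
      (\<integral>x. indicator D x * (- ln t + info M \<beta> x) \<partial>M) < \<epsilon> / 8"
    using small[OF B] by blast
  obtain dA where dA: "0 < dA" "\<And>D. D \<in> sets M \<Longrightarrow> measure M D < dA \<Longrightarrow>
      (\<integral>x. indicator D x * (- ln t + info M \<alpha> x) \<partial>M) < \<epsilon> / 8"
    using small[OF A] by blast

  \<comment> \<open>Outside a set of measure below \<open>dA / 2\<close>, the function
    \<open>a\<close> of the \<open>\<beta>\<close>-name over \<open>L\<close> gives the true atom of
    \<open>\<alpha>\<close>.\<close>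
  obtain KA where KA: "finite KA" "KA \<subseteq> \<alpha>" "measure M {x \<in> space M. atom \<alpha> x \<notin> KA} < dA / 4"
    using ex_finite_large_subpartition[OF PA, of "dA / 4"] dA(1) by auto
  obtain L a where L: "finite L" "L \<subseteq> carrier G" and a: "name_determined G M T \<beta> L a"
    "a \<in> measurable M (count_space (insert None (Some ` KA)))"
    "measure M {x \<in> space M. a x \<noteq> trunc KA (atom \<alpha> x)} < dA / 4"
    using approximate_by_names[OF PB genB PA KA(1,2), of "dA / 4"] dA(1) by auto

  \<comment> \<open>\<open>b\<close> will misread the atom of \<open>\<beta>\<close> on a set
    \<open>W\<close> of measure below \<open>2 * \<kappa>\<close>. This must stay below
    \<open>dB\<close>, and the translates of \<open>W\<close> over \<open>L\<close> may cost at most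
    \<open>dA / 2\<close>; hence \<open>L\<close> is fixed first.\<close>
  define \<kappa> where "\<kappa> = min (dB / 2) (dA / (4 * (real (card L) + 1)))"
  have \<kappa>: "0 < \<kappa>" using dA(1) dB(1) by (simp add: \<kappa>_def)
  obtain K where K: "finite K" "K \<subseteq> \<beta>" "measure M {x \<in> space M. atom \<beta> x \<notin> K} < \<kappa>"
    using ex_finite_large_subpartition[OF PB \<kappa>] .
  define V where "V = insert None (Some ` K)"
  have V: "finite V" "countable V" using K(1) by (auto simp: V_def countable_finite)
  have "1 \<le> card V" using V(1) by (simp add: V_def card_insert_if)
  then have "0 \<le> ln (real (card V))" by (intro ln_ge_zero) simp
  then have c: "0 \<le> ln (card V) - ln t" using lnt0 by simp
  \<comment> \<open>Each unit of mass on which \<open>b\<close> differs from the truncation costs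
    \<open>ln (card V) - ln t\<close>; \<open>c0\<close> keeps the total within
    \<open>\<epsilon> / 8\<close>, and the added 1 keeps the denominator positive.\<close>
  define c0 where "c0 = \<epsilon> / (8 * (ln (card V) - ln t + 1))"
  have c0: "0 < c0" "c0 * (ln (card V) - ln t) \<le> \<epsilon> / 8"
    using e c by (auto simp: c0_def field_simps)
  obtain F b where F: "finite F" "F \<subseteq> carrier G" and b: "name_determined G M T \<alpha> F b"
    "b \<in> measurable M (count_space V)"
    "measure M {x \<in> space M. b x \<noteq> trunc K (atom \<beta> x)} < min \<kappa> c0"
    unfolding V_def using approximate_by_names[OF PA genA PB K(1,2), of "min \<kappa> c0"] \<kappa> c0(1) by auto
  \<comment> \<open>\<open>E0\<close> measures \<open>b\<close> against the truncated atom,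
    \<open>W\<close> against the full one: the first enters when \<open>b\<close> is predicted from
    \<open>\<beta>\<close>, the second when \<open>\<beta>\<close> is predicted from
    \<open>b\<close>.\<close>
  define E0 where "E0 = {x \<in> space M. b x \<noteq> trunc K (atom \<beta> x)}"
  define W where "W = {x \<in> space M. b x \<noteq> Some (atom \<beta> x)}"
  have sE0: "E0 \<in> sets M" and sW: "W \<in> sets M"
    unfolding E0_def W_def
    using sets_Collect_label_atom[OF b(2) V(2) PB, of "\<lambda>v B. v \<noteq> trunc K B"]
      sets_Collect_label_atom[OF b(2) V(2) PB, of "\<lambda>v B. v \<noteq> Some B"] by auto
  have mW: "measure M W < 2 * \<kappa>"
  proof -
    have s: "{x \<in> space M. atom \<beta> x \<notin> K} \<in> sets M"
      using sets_Collect_label_atom[OF b(2) V(2) PB, of "\<lambda>v B. B \<notin> K"] .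
    have "measure M W \<le> measure M (E0 \<union> {x \<in> space M. atom \<beta> x \<notin> K})"
      using sE0 s by (intro finite_measure_mono) (auto simp: E0_def W_def trunc_def)
    also have "\<dots> \<le> measure M E0 + measure M {x \<in> space M. atom \<beta> x \<notin> K}"
      by (rule measure_Un_le[OF sE0 s])
    finally show ?thesis using K(3) b(3) by (simp add: E0_def)
  qed

  \<comment> \<open>Guessing the atom of \<open>\<alpha>\<close> from values of
    \<open>b\<close>\<close>
  obtain x0 where x0: "x0 \<in> space M" using not_empty by blast
  \<comment> \<open>The atom of \<open>x0\<close> is a default for an undecided \<open>a\<close>; a
    wrong default is absorbed by \<open>E\<close>.\<close>
  define ah where "ah = (\<lambda>x. case a x of Some A \<Rightarrow> A | None \<Rightarrow> atom \<alpha> x0)"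
  define nm where "nm = (\<lambda>x. \<lambda>g\<in>L. b (T (inv g) x))"
  \<comment> \<open>Any point whose \<open>\<beta>\<close>-name over \<open>L\<close> is \<open>c\<close> gives the same guess; for other \<open>c\<close> the guess is junk,
    which only enlarges \<open>E\<close>.\<close>
  define pick where
    "pick = (\<lambda>c. SOME x. x \<in> space M \<and> (\<forall>g\<in>L. Some (atom \<beta> (T (inv g) x)) = c g))"
  define E where "E = {x \<in> space M. ah (pick (nm x)) \<noteq> atom \<alpha> x}"
  have TL: "T (inv g) x \<in> space M" if "g \<in> L" "x \<in> space M" for g x
    using that L(2) by (intro T_space) auto
  have nm_meas: "nm \<in> measurable M (count_space (L \<rightarrow>\<^sub>E V))"
  proof (subst measurable_count_space_eq2)
    show "finite (L \<rightarrow>\<^sub>E V)" using L(1) V(1) by (rule finite_PiE)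
    have "nm -` {c} \<inter> space M \<in> sets M" if c: "c \<in> L \<rightarrow>\<^sub>E V" for c
    proof -
      have "nm -` {c} \<inter> space M = {x \<in> space M. \<forall>g\<in>L. b (T (inv g) x) = c g}"
        using c by (auto simp: nm_def PiE_iff extensional_def fun_eq_iff)
      also have "\<dots> \<in> sets M"
      proof (rule sets.sets_Collect_finite_All[OF _ L(1)])
        fix g assume g: "g \<in> L"
        have "(\<lambda>x. b (T (inv g) x)) \<in> measurable M (count_space V)"
          using g L(2) by (intro measurable_compose[OF measurable_T b(2)]) auto
        then have "(\<lambda>x. b (T (inv g) x)) -` {c g} \<inter> space M \<in> sets M"
          using c g by (intro measurable_sets) auto
        moreover have "{x \<in> space M. b (T (inv g) x) = c g} = (\<lambda>x. b (T (inv g) x)) -` {c g} \<inter> space M"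
          by auto
        ultimately show "{x \<in> space M. b (T (inv g) x) = c g} \<in> sets M" by simp
      qed
      finally show ?thesis .
    qed
    moreover have "nm \<in> space M \<rightarrow> (L \<rightarrow>\<^sub>E V)"
      using measurable_space[OF b(2)] TL by (auto simp: nm_def)
    ultimately show "nm \<in> space M \<rightarrow> (L \<rightarrow>\<^sub>E V) \<and> (\<forall>c\<in>L \<rightarrow>\<^sub>E V. nm -` {c} \<inter> space M \<in> sets M)"
      by blast
  qed
  have cV: "countable (L \<rightarrow>\<^sub>E V)" using L(1) V(1) by (intro countable_finite finite_PiE)
  have sE: "E \<in> sets M"
    unfolding E_def
    using sets_Collect_label_atom[OF nm_meas cV PA, of "\<lambda>c A. ah (pick c) \<noteq> A"] .
  have mE: "measure M E < dA"
  proof -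
    let ?X = "{x \<in> space M. a x \<noteq> trunc KA (atom \<alpha> x)}" and ?Y = "{x \<in> space M. atom \<alpha> x \<notin> KA}"
    let ?Z = "\<Union>g\<in>L. T (inv g) -` W \<inter> space M"
    have cK: "countable (insert None (Some ` KA))" using KA(1) by (simp add: countable_finite)
    have sX: "?X \<in> sets M" and sY: "?Y \<in> sets M"
      using sets_Collect_label_atom[OF a(2) cK PA, of "\<lambda>v B. v \<noteq> trunc KA B"]
        sets_Collect_label_atom[OF a(2) cK PA, of "\<lambda>v B. B \<notin> KA"] by auto
    have sT: "T (inv g) -` W \<inter> space M \<in> sets M" if "g \<in> L" for g
      using that L(2) sW by (intro measurable_sets[OF measurable_T]) auto
    then have sZ: "?Z \<in> sets M" using L(1) by (intro sets.finite_UN) auto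
    \<comment> \<open>Off \<open>?Z\<close> the values of \<open>b\<close> over \<open>L\<close> are
      the true \<open>\<beta>\<close>-name, so \<open>pick\<close> returns a point with the same
      name and hence the same value of \<open>a\<close>. Off \<open>?X\<close> and \<open>?Y\<close>
      that value is the true atom of \<open>\<alpha>\<close>.\<close>
    have "E \<subseteq> ?X \<union> ?Y \<union> ?Z"
    proof (rule subsetI, rule ccontr)
      fix x assume xE: "x \<in> E" and nx: "x \<notin> ?X \<union> ?Y \<union> ?Z"
      have x: "x \<in> space M" using xE by (simp add: E_def)
      have nmx: "Some (atom \<beta> (T (inv g) x)) = nm x g" if g: "g \<in> L" for g
      proof -
        have "T (inv g) x \<notin> W" using nx x g by blast
        then show ?thesis using TL[OF g x] g by (simp add: W_def nm_def)
      qed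
      have pk: "pick (nm x) \<in> space M \<and> (\<forall>g\<in>L. Some (atom \<beta> (T (inv g) (pick (nm x)))) = nm x g)"
        unfolding pick_def
        by (rule someI[where P = "\<lambda>y. y \<in> space M \<and> (\<forall>g\<in>L. Some (atom \<beta> (T (inv g) y)) = nm x g)" and x = x])
          (use x nmx in blast)
      have "a (pick (nm x)) = a x"
      proof (rule name_determinedD[OF a(1) _ x])
        show "atom \<beta> (T (inv g) (pick (nm x))) = atom \<beta> (T (inv g) x)" if "g \<in> L" for g
          using pk nmx[OF that] that by (metis option.inject)
      qed (use pk in blast)
      also have "a x = Some (atom \<alpha> x)"
        using nx x by (simp add: trunc_def split: if_splits)
      finally show False using xE by (simp add: E_def ah_def)
    qed
    then have "measure M E \<le> measure M (?X \<union> ?Y \<union> ?Z)"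
      using sX sY sZ by (intro finite_measure_mono) auto
    also have "\<dots> \<le> measure M (?X \<union> ?Y) + measure M ?Z"
      by (rule measure_Un_le[OF sets.Un[OF sX sY] sZ])
    also have "measure M (?X \<union> ?Y) \<le> measure M ?X + measure M ?Y"
      by (rule measure_Un_le[OF sX sY])
    also have "measure M ?X + measure M ?Y < dA / 2" using a(3) KA(3) by simp
    also have "measure M ?Z \<le> (\<Sum>g\<in>L. measure M (T (inv g) -` W \<inter> space M))"
      using L(1) sT by (intro finite_measure_subadditive_finite) auto
    also have "\<dots> = (\<Sum>g\<in>L. measure M W)"
      \<comment> \<open>By invariance every translate of \<open>W\<close> has the measure of
        \<open>W\<close>.\<close>
      using L(2) sW by (intro sum.cong measure_vimage_T) auto
    also have "\<dots> \<le> dA / 2"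
    proof -
      have "real (card L) * measure M W \<le> (real (card L) + 1) * (2 * \<kappa>)"
        using mW by (intro mult_mono) auto
      also have "\<dots> \<le> (real (card L) + 1) * (2 * (dA / (4 * (real (card L) + 1))))"
        by (intro mult_left_mono) (auto simp: \<kappa>_def)
      also have "\<dots> = dA / 2" by (simp add: field_simps)
      finally show ?thesis by simp
    qed
    finally show ?thesis by simp
  qed

  \<comment> \<open>The partition \<open>\<alpha>'\<close> and its measurability\<close>
  define l where "l = (\<lambda>x. (b x, if x \<in> E then Some (atom \<alpha> x) else None))"
  define \<alpha>' where "\<alpha>' = fibres M l"
  have l_meas: "l \<in> measurable M (count_space (V \<times> insert None (Some ` \<alpha>)))"
  proof (subst measurable_count_space_eq_countable)
    show "countable (V \<times> insert None (Some ` \<alpha>))"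
      using V(2) PA by (auto simp: mpart_def)
    have "l -` {w} \<inter> space M \<in> sets M" for w
    proof -
      have "l x = w \<longleftrightarrow> b x = fst w \<and>
          (if ah (pick (nm x)) \<noteq> atom \<alpha> x then Some (atom \<alpha> x) else None) = snd w" if "x \<in> space M" for x
        using that by (simp add: l_def E_def prod_eq_iff)
      then have "l -` {w} \<inter> space M = {x \<in> space M. b x = fst w} \<inter>
          {x \<in> space M. (if ah (pick (nm x)) \<noteq> atom \<alpha> x then Some (atom \<alpha> x) else None) = snd w}"
        by blast
      also have "\<dots> \<in> sets M"
        using sets_Collect_label_atom[OF b(2) V(2) PA, of "\<lambda>v A. v = fst w"]
          sets_Collect_label_atom[OF nm_meas cV PA,
            of "\<lambda>c A. (if ah (pick c) \<noteq> A then Some A else None) = snd w"]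
        by (rule sets.Int)
      finally show ?thesis .
    qed
    moreover have "l \<in> space M \<rightarrow> V \<times> insert None (Some ` \<alpha>)"
      using measurable_space[OF b(2)] atom_in(1)[OF PA] by (auto simp: l_def)
    ultimately show "l \<in> space M \<rightarrow> V \<times> insert None (Some ` \<alpha>) \<and>
        (\<forall>w\<in>V \<times> insert None (Some ` \<alpha>). l -` {w} \<inter> space M \<in> sets M)"
      by blast
  qed
  have P': "mpart M \<alpha>'"
    unfolding \<alpha>'_def using l_meas by (rule mpart_fibres) (use V(2) PA in \<open>auto simp: mpart_def\<close>)
  have atom': "atom \<alpha>' x = {y \<in> space M. l y = l x}" if "x \<in> space M" for x
    unfolding \<alpha>'_def by (rule atom_fibres[OF P'[unfolded \<alpha>'_def] that])

  \<comment> \<open>Finite entropy\<close>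
  have "fin_ent_part M \<alpha>'"
  proof -
    \<comment> \<open>Condition on the trivial partition with the constant guess
      \<open>None\<close>; what is taken from the kernel estimate is summability.\<close>
    have PX: "mpart M {space M}" by (auto simp: mpart_def)
    have "(\<lambda>C. ent_term (measure M C)) summable_on \<alpha>'"
      unfolding \<alpha>'_def
    proof (rule summable_entropy_of_cond[OF cond_entropy_fibres(1)[OF A PX t b(2) V(1) sE l_def]])
      show "mpart M (fibres M l)" "mpart M (fibres M l)" using P' by (auto simp: \<alpha>'_def)
      show "{x \<in> space M. b x \<noteq> (\<lambda>_. None) (atom {space M} x)} \<in> sets M"
        using sets_Collect_label_atom[OF b(2) V(2) PA, of "\<lambda>v A. v \<noteq> None"] by simp
    qed
    then show ?thesis using P' by (simp add: fin_ent_part_def mpart_def)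
  qed

  \<comment> \<open>Equivalence with \<open>\<alpha>\<close>\<close>
  moreover have "S_equivalent G M T S \<alpha>' \<alpha>"
  proof -
    \<comment> \<open>\<open>nm\<close> reads \<open>b\<close> over \<open>L\<close> and
      \<open>b\<close> reads \<open>\<alpha>\<close> over \<open>F\<close>, so together they see the
      product window. \<open>F\<close> itself serves \<open>b x\<close>, and the identity serves the
      atom of \<open>\<alpha>\<close> at \<open>x\<close>.\<close>
    define LF where "LF = (\<lambda>(g, h). g \<otimes> h) ` (L \<times> F)"
    have fin: "finite (F \<union> LF)" and car: "F \<union> LF \<subseteq> carrier G"
      using L F by (auto simp: LF_def)
    obtain F1 where F1: "finite F1" "F1 \<subseteq> carrier G" "F \<union> LF \<subseteq> F1" "\<one> \<in> F1" "S_connected G S F1"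
      using ex_S_connected_superset[OF S fin car] .
    obtain F2 where F2: "finite F2" "F2 \<subseteq> carrier G" "L \<subseteq> F2" "\<one> \<in> F2" "S_connected G S F2"
      using ex_S_connected_superset[OF S L] .
    have "name_determined G M T \<alpha> F1 (atom \<alpha>')"
      unfolding name_determined_def
    proof (intro ballI impI)
      fix x y assume xy: "x \<in> space M" "y \<in> space M"
        and eq: "\<forall>g\<in>F1. atom \<alpha> (T (inv g) x) = atom \<alpha> (T (inv g) y)"
      have "b (T (inv g) x) = b (T (inv g) y)" if g: "g \<in> L" for g
      proof (rule name_determinedD[OF b(1) TL[OF g xy(1)] TL[OF g xy(2)]])
        fix h assume h: "h \<in> F"
        have "g \<otimes> h \<in> F1" using g h F1(3) by (auto simp: LF_def)
        moreover have "g \<in> carrier G" "h \<in> carrier G" using g h L(2) F(2) by auto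
        ultimately show "atom \<alpha> (T (inv h) (T (inv g) x)) = atom \<alpha> (T (inv h) (T (inv g) y))"
          using eq xy by (simp flip: T_inv_mult)
      qed
      then have "nm x = nm y" by (auto simp: nm_def fun_eq_iff)
      moreover have "b x = b y"
        by (rule name_determinedD[OF b(1) xy]) (use eq F1(3) in blast)
      moreover have "atom \<alpha> x = atom \<alpha> y"
        using eq F1(4) xy T_one by force
      ultimately have "l x = l y" using xy by (simp add: l_def E_def)
      then show "atom \<alpha>' x = atom \<alpha>' y" using xy by (simp add: atom')
    qed
    then have "part_le M \<alpha>' (join_over G M T F1 \<alpha>)"
      by (rule part_le_join_over[OF P' PA F1(2)])
    \<comment> \<open>Decoding: the label at \<open>x\<close> shows whether \<open>x\<close> lies in
      \<open>E\<close>. If so, it contains the atom of \<open>\<alpha>\<close>; if not, the guess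
      from \<open>nm\<close>, visible over \<open>L\<close>, is correct.\<close>
    moreover have "name_determined G M T \<alpha>' F2 (atom \<alpha>)"
      unfolding name_determined_def
    proof (intro ballI impI)
      fix x y assume xy: "x \<in> space M" "y \<in> space M"
        and eq: "\<forall>g\<in>F2. atom \<alpha>' (T (inv g) x) = atom \<alpha>' (T (inv g) y)"
      have leq: "l (T (inv g) x) = l (T (inv g) y)" if g: "g \<in> F2" for g
      proof -
        have x: "T (inv g) x \<in> space M" and y: "T (inv g) y \<in> space M"
          using g F2(2) xy by (auto intro!: T_space)
        have "T (inv g) x \<in> atom \<alpha>' (T (inv g) y)"
          using eq g atom_in(2)[OF P' x] by simp
        then show ?thesis by (simp add: atom'[OF y])
      qed
      have "l x = l y" using leq[OF F2(4)] xy by (simp add: T_one)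
      moreover have "nm x = nm y"
        using leq F2(3) by (auto simp: nm_def fun_eq_iff l_def)
      ultimately show "atom \<alpha> x = atom \<alpha> y"
        using xy by (auto simp: l_def E_def split: if_splits)
    qed
    then have "part_le M \<alpha> (join_over G M T F2 \<alpha>')"
      by (rule part_le_join_over[OF PA P' F2(2)])
    ultimately show ?thesis
      using F1 F2 unfolding S_equivalent_def by blast
  qed

  \<comment> \<open>The distance to \<open>\<beta>\<close>\<close>
  moreover have "rohlin_dist M \<alpha>' \<beta> < \<epsilon>"
  proof -
    \<comment> \<open>The guess for \<open>b\<close> from the atom of \<open>\<beta>\<close> is its
      truncation \<open>trunc K\<close>.\<close>
    have "cond_entropy M \<alpha>' \<beta> \<le> - 2 * ln (1 - t) + measure M E0 * (ln (card V) - ln t)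
           + (\<integral>x. indicator E x * (- ln t + info M \<alpha> x) \<partial>M)"
      unfolding \<alpha>'_def E0_def
      by (rule cond_entropy_fibres(2)[OF A PB t b(2) V(1) sE l_def P'[unfolded \<alpha>'_def] sE0[unfolded E0_def]])
    moreover have "measure M E0 * (ln (card V) - ln t) \<le> c0 * (ln (card V) - ln t)"
      using b(3) c by (intro mult_right_mono) (auto simp: E0_def)
    ultimately have 1: "cond_entropy M \<alpha>' \<beta> < \<epsilon> / 2"
      using dA(2)[OF sE mE] c0(2) lnt e by simp
    \<comment> \<open>In the other direction the first label coordinate \<open>b\<close> is the
      guess for the atom of \<open>\<beta>\<close>, and it fails exactly on
      \<open>W\<close>.\<close>
    have "label l (atom \<alpha>' x) = l x" if "x \<in> space M" for x
      using that by (simp add: atom' label_fibre)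
    then have W: "{x \<in> space M. fst (label l (atom \<alpha>' x)) \<noteq> Some (atom \<beta> x)} = W"
      unfolding W_def by (auto simp: l_def)
    have "cond_entropy M \<beta> \<alpha>' \<le> - ln (1 - t) + (\<integral>x. indicator W x * (- ln t + info M \<beta> x) \<partial>M)"
      using cond_entropy_guess[OF B P' t, of "\<lambda>C. fst (label l C)"] sW unfolding W .
    moreover have "measure M W < dB" using mW by (simp add: \<kappa>_def)
    ultimately have "cond_entropy M \<beta> \<alpha>' < \<epsilon> / 2"
      using dB(2)[OF sW] lnt e by simp
    then show ?thesis using 1 by (simp add: rohlin_dist_def)
  qed
  ultimately show ?thesis by blast
qed

theorem theorem4p6:
  fixes G :: "('g, 'b) monoid_scheme" and M :: "'a measure" and T :: "'g \<Rightarrow> 'a \<Rightarrow> 'a"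
    and S :: "'g set" and \<alpha> \<beta> :: "'a set set" and \<epsilon> :: real
  assumes "G_system G M T"
    and "countable (carrier G)"
    and "S \<subseteq> carrier G" and "generate G S = carrier G"
    and "fin_ent_part M \<alpha>" and "fin_ent_part M \<beta>"
    and "generating G M T \<alpha>" and "generating G M T \<beta>"
    and "\<epsilon> > 0"
  shows "\<exists>\<alpha>'. fin_ent_part M \<alpha>' \<and> S_equivalent G M T S \<alpha>' \<alpha> \<and> rohlin_dist M \<alpha>' \<beta> < \<epsilon>"
proof -
  interpret gsystem G M T by unfold_locales (fact assms(1))
  show ?thesis using S_equivalent_dense assms(3-9) by blast
qed

end
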